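(* The solutions of the equation $$\left\langle\begin{pmatrix}0&0\\0&1\end{pmatrix}Y,N_Y\right\rangle=k_Y^{1/3}$$ for curves $Y$ in $\mathbb{R}^2$ are the following curves: (1) The lines $x=C$ and $y=0$, with $C$ any constant. (2) The hyperbolas $(x-C)y=\pm\sqrt2$, with $C$ any constant. (3) $(x-C_2)^2-\left(\int_{\sqrt[4]{2C_1}}^{y}\frac{1}{\sqrt{\frac12\xi^4-C_1}}\,d\xi\right)^2=0$ with $y\ge\sqrt[4]{2C_1}$, which is the graph of a convex function with only one minimum point, at $x=C_2$. Here $C_1$ is a positive constant (and $C_2$ any constant). (4) $(x-C_2)^2-\left(\int_{y}^{-\sqrt[4]{2C_1}}\frac{1}{\sqrt{\frac12\xi^4-C_1}}\,d\xi\right)^2=0$ with $y\le-\sqrt[4]{2C_1}$, which is the graph of a concave function with only one maximum point, at $x=C_2$. Here $C_1$ is a positive constant (and $C_2$ any constant). (5) $x=\int_0^y\frac{1}{\sqrt{\frac12\xi^4+C_1}}\,d\xi+C_2$ with $C_1>0$ (and $C_2$ any constant), which is the graph of an increasing function with only one inflection point, at $x=C_2$. (6) $x=-\int_0^y\frac{1}{\sqrt{\frac12\xi^4+C_1}}\,d\xi+C_2$ with $C_1>0$ (and $C_2$ any constant), which is the graph of a decreasing function with only one inflection point, at $x=C_2$.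
   Context: Points of $\mathbb{R}^2$ are written as $(x,y)$. Curves are smooth immersed curves. For a curve $Y=Y(u)$, put $T=Y_u/\|Y_u\|$, $N_Y=JT$ with $J=\begin{pmatrix}0&-1\\1&0\end{pmatrix}$ (unit normal), and $k_Y=\det(Y_u,Y_{uu})/\|Y_u\|^3$ (curvature with respect to $N_Y$). $\langle\cdot,\cdot\rangle$ is the Euclidean inner product and $k^{1/3}$ is the real (odd) cube root. Solutions are regarded as geometric curves (up to reparametrization), connected and maximally extended; for the hyperbolas, each branch is a solution curve. The functions in (3)--(6) are functions of $x$ on (possibly bounded) intervals. *)

theory Defs
  imports "HOL-Analysis.Analysis"
begin

primrec nth_vderiv :: "nat \<Rightarrow> (real \<Rightarrow> 'a::real_normed_vector) \<Rightarrow> real \<Rightarrow> 'a" where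
  "nth_vderiv 0 Y = Y"
| "nth_vderiv (Suc n) Y = (\<lambda>u. vector_derivative (nth_vderiv n Y) (at u))"

definition smooth_on_open :: "real set \<Rightarrow> (real \<Rightarrow> 'a::real_normed_vector) \<Rightarrow> bool" where
  "smooth_on_open I Y \<longleftrightarrow> open I \<and> (\<forall>n. \<forall>u\<in>I. nth_vderiv n Y differentiable (at u))"

definition open_interval :: "real set \<Rightarrow> bool" where
  "open_interval I \<longleftrightarrow> open I \<and> is_interval I \<and> I \<noteq> {}"

text \<open>A connected immersed curve is given by a parametrization on a nonempty open interval
  (possibly unbounded); a closed curve would be given by a periodic parametrization.
  The values of \<open>Y\<close> outside \<open>I\<close> are irrelevant.\<close>

definition immersed_curve :: "real set \<Rightarrow> (real \<Rightarrow> real^2) \<Rightarrow> bool" where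
  "immersed_curve I Y \<longleftrightarrow>
     open_interval I \<and> smooth_on_open I Y \<and> (\<forall>u\<in>I. nth_vderiv 1 Y u \<noteq> 0)"

definition rot :: "real^2^2" where
  "rot = vector [vector [0, -1], vector [1, 0]]"

definition tangent :: "(real \<Rightarrow> real^2) \<Rightarrow> real \<Rightarrow> real^2" where
  "tangent Y u = nth_vderiv 1 Y u /\<^sub>R norm (nth_vderiv 1 Y u)"

definition normal_vec :: "(real \<Rightarrow> real^2) \<Rightarrow> real \<Rightarrow> real^2" where
  "normal_vec Y u = rot *v tangent Y u"

definition curvature :: "(real \<Rightarrow> real^2) \<Rightarrow> real \<Rightarrow> real" where
  "curvature Y u =
     det (transpose (vector [nth_vderiv 1 Y u, nth_vderiv 2 Y u] :: real^2^2))
       / norm (nth_vderiv 1 Y u) ^ 3"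

text \<open>For odd \<open>n\<close>, \<^term>\<open>root n\<close> is the odd real root on all of \<open>\<real>\<close>.\<close>

definition solution :: "real set \<Rightarrow> (real \<Rightarrow> real^2) \<Rightarrow> bool" where
  "solution I Y \<longleftrightarrow> immersed_curve I Y \<and>
     (\<forall>u\<in>I. ((vector [vector [0, 0], vector [0, 1]] :: real^2^2) *v Y u) \<bullet> normal_vec Y u
              = root 3 (curvature Y u))"

text \<open>\<open>Y\<close> is a reparametrization of the restriction of \<open>Z\<close> to \<open>\<phi> ` I\<close>; the parameter change may
  reverse the orientation.\<close>

definition reparam_into ::
    "(real \<Rightarrow> real) \<Rightarrow> real set \<Rightarrow> (real \<Rightarrow> real^2) \<Rightarrow> real set \<Rightarrow> (real \<Rightarrow> real^2) \<Rightarrow> bool" where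
  "reparam_into \<phi> I Y J Z \<longleftrightarrow> smooth_on_open I \<phi> \<and>
     (\<forall>u\<in>I. nth_vderiv 1 \<phi> u \<noteq> 0 \<and> \<phi> u \<in> J \<and> Y u = Z (\<phi> u))"

definition maximal_solution :: "real set \<Rightarrow> (real \<Rightarrow> real^2) \<Rightarrow> bool" where
  "maximal_solution I Y \<longleftrightarrow> solution I Y \<and>
     (\<forall>J Z \<phi>. solution J Z \<and> reparam_into \<phi> I Y J Z \<longrightarrow> \<phi> ` I = J)"

text \<open>The geometric curve of \<open>(I, Y)\<close> is \<open>S\<close>, run through exactly once.\<close>

definition parametrizes :: "real set \<Rightarrow> (real \<Rightarrow> real^2) \<Rightarrow> (real^2) set \<Rightarrow> bool" where
  "parametrizes I Y S \<longleftrightarrow> immersed_curve I Y \<and> inj_on Y I \<and> Y ` I = S"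

definition vertical_line :: "real \<Rightarrow> (real^2) set" where
  "vertical_line C = {p. p$1 = C}"

definition x_axis :: "(real^2) set" where
  "x_axis = {p. p$2 = 0}"

text \<open>The branches of a hyperbola are its connected components.\<close>

definition hyperbola_branches :: "real \<Rightarrow> (real^2) set set" where
  "hyperbola_branches C =
     components {p. (p$1 - C) * p$2 = sqrt 2} \<union> components {p. (p$1 - C) * p$2 = - sqrt 2}"

text \<open>\<open>LBINT \<xi>=a..b\<close> is the oriented Lebesgue integral over the open interval between \<open>a\<close> and \<open>b\<close>,
  so the singularity of the integrand at the vertex is harmless and \<open>b < a\<close> is allowed.\<close>

definition convex_curve :: "real \<Rightarrow> real \<Rightarrow> (real^2) set" where
  "convex_curve C1 C2 = {p. p$2 \<ge> root 4 (2 * C1) \<and>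
     (p$1 - C2)\<^sup>2 - (LBINT \<xi>=root 4 (2 * C1)..p$2. 1 / sqrt (1/2 * \<xi>^4 - C1))\<^sup>2 = 0}"

definition concave_curve :: "real \<Rightarrow> real \<Rightarrow> (real^2) set" where
  "concave_curve C1 C2 = {p. p$2 \<le> - root 4 (2 * C1) \<and>
     (p$1 - C2)\<^sup>2 - (LBINT \<xi>=p$2..- root 4 (2 * C1). 1 / sqrt (1/2 * \<xi>^4 - C1))\<^sup>2 = 0}"

definition increasing_curve :: "real \<Rightarrow> real \<Rightarrow> (real^2) set" where
  "increasing_curve C1 C2 = {p. p$1 = (LBINT \<xi>=0..p$2. 1 / sqrt (1/2 * \<xi>^4 + C1)) + C2}"

definition decreasing_curve :: "real \<Rightarrow> real \<Rightarrow> (real^2) set" where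
  "decreasing_curve C1 C2 = {p. p$1 = - (LBINT \<xi>=0..p$2. 1 / sqrt (1/2 * \<xi>^4 + C1)) + C2}"

definition classified_curves :: "(real^2) set set" where
  "classified_curves =
     {vertical_line C | C. True} \<union> {x_axis}
     \<union> (\<Union>C. hyperbola_branches C)
     \<union> {convex_curve C1 C2 | C1 C2. C1 > 0}
     \<union> {concave_curve C1 C2 | C1 C2. C1 > 0}
     \<union> {increasing_curve C1 C2 | C1 C2. C1 > 0}
     \<union> {decreasing_curve C1 C2 | C1 C2. C1 > 0}"

definition graph_on :: "real set \<Rightarrow> (real \<Rightarrow> real) \<Rightarrow> (real^2) set" where
  "graph_on I f = {vector [x, f x] | x. x \<in> I}"

text \<open>The second derivative exists near \<open>c\<close> and changes sign strictly at \<open>c\<close>.\<close>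

definition inflection_point :: "real set \<Rightarrow> (real \<Rightarrow> real) \<Rightarrow> real \<Rightarrow> bool" where
  "inflection_point I f c \<longleftrightarrow> (\<exists>e>0. {c - e<..<c + e} \<subseteq> I \<and>
     (\<forall>x\<in>{c - e<..<c + e}. f differentiable (at x) \<and> deriv f differentiable (at x)) \<and>
     ((\<forall>x\<in>{c - e<..<c}. deriv (deriv f) x < 0) \<and> (\<forall>x\<in>{c<..<c + e}. deriv (deriv f) x > 0) \<or>
      (\<forall>x\<in>{c - e<..<c}. deriv (deriv f) x > 0) \<and> (\<forall>x\<in>{c<..<c + e}. deriv (deriv f) x < 0)))"

end

theory Submission
  imports Defs
begin

text \<open>For a curve \<open>(x, y)\<close> the equation, raised to the third power, becomes the polynomial
  identity \<open>x' y'' - y' x'' = y\<^sup>3 x'\<^sup>3\<close> (\<open>solution_iff\<close>). It is homogeneous linear in \<open>x'\<close>,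
  so \<open>x'\<close> vanishes either everywhere or nowhere (\<open>vertical_or_graph\<close>): a solution lies on a
  vertical line or is a graph over the x-axis. In particular every solution curve is
  injective.

  On a graph with slope \<open>q = y'/x'\<close> the equation is \<open>dq/dx = y\<^sup>3\<close>, that is, \<open>f'' = f\<^sup>3\<close>, and
  the energy \<open>q\<^sup>2 - y\<^sup>4/2\<close> is constant. Its sign tells the classes apart. If it is positive,
  \<open>q\<close> has no zeros and separation of variables gives the increasing and the decreasing
  curves (\<open>positive_energy\<close>). If it is zero, then \<open>q = y\<^sup>2/\<surd>2\<close> or \<open>q = - y\<^sup>2/\<surd>2\<close>, which
  gives the x-axis and the hyperbolas (\<open>zero_energy\<close>). If it is \<open>- a\<^sup>4/2\<close>, then \<open>q\<close> may
  vanish at a vertex with \<open>\<bar>y\<bar> = a\<close>. The parameter \<open>s\<close> with \<open>\<bar>y\<bar> = a + s\<^sup>2\<close>, signed like the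
  slope of \<open>\<bar>y\<bar>\<close>, resolves this point: in terms of \<open>s\<close> the travelled horizontal distance has
  the positive smooth density \<open>2 / slope_neg a s\<close> (\<open>negative_energy\<close>). This gives the convex
  and the concave curves.

  Maximality needs no analysis of blow-up. Each curve of the list is a closed subset of the
  plane and the image of a solution defined on the whole line (\<open>classified_complete\<close>). An
  injective solution that extends a parametrization of such a curve meets it in a set of
  parameters that is both open and closed, so it extends nothing
  (\<open>parametrization_maximal\<close>). Conversely, a solution that lies in such a curve factors
  through its standard parametrization by a smooth parameter change, so if it is maximal it
  runs through all of the curve (\<open>maximal_solution_onto\<close>).

  The shape of the graphs follows from \<open>f'' = f\<^sup>3\<close>.\<close>

  

section \<open>Smooth functions of one variable\<close>

text \<open>The notion \<open>smooth_on_open\<close> speaks of iterated \<open>vector_derivative\<close>s, which are awkward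
  to compute. Counting derivatives by existence instead turns every closure property of
  smooth functions into an induction on their number; outside \<open>I\<close> the derivatives may be
  anything.\<close>

  

primrec diff_times :: "real set \<Rightarrow> nat \<Rightarrow> (real \<Rightarrow> 'a::real_normed_vector) \<Rightarrow> bool" where
  "diff_times I 0 f \<longleftrightarrow> True"
| "diff_times I (Suc n) f \<longleftrightarrow>
     (\<exists>f'. (\<forall>u\<in>I. (f has_vector_derivative f' u) (at u)) \<and> diff_times I n f')"

lemma diff_times_cong:
  assumes "open I" "\<And>u. u \<in> I \<Longrightarrow> f u = g u" "diff_times I n f"
  shows "diff_times I n g"
proof (cases n)
  case (Suc m)
  then obtain f' where f': "\<And>u. u \<in> I \<Longrightarrow> (f has_vector_derivative f' u) (at u)" "diff_times I m f'"
    using assms(3) by auto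
  have "(g has_vector_derivative f' u) (at u)" if "u \<in> I" for u
    by (rule has_vector_derivative_transform_within_open[OF f'(1)[OF that] assms(1) that assms(2)])
  with f'(2) Suc show ?thesis by auto
qed simp

lemma smooth_iff_diff_times:
  fixes f :: "real \<Rightarrow> 'a::real_normed_vector"
  assumes I: "open I"
  shows "smooth_on_open I f \<longleftrightarrow> (\<forall>n. diff_times I n f)"
proof
  assume f: "smooth_on_open I f"
  have "diff_times I n (nth_vderiv k f)" for n k
  proof (induction n arbitrary: k)
    case (Suc n)
    have "(nth_vderiv k f has_vector_derivative nth_vderiv (Suc k) f u) (at u)" if "u \<in> I" for u
      using f that by (auto simp: smooth_on_open_def vector_derivative_works)
    with Suc.IH[of "Suc k"] show ?case
      unfolding diff_times.simps by blast
  qed simp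
  from this[of _ 0] show "\<forall>n. diff_times I n f" by simp
next
  assume f: "\<forall>n. diff_times I n f"
  have *: "diff_times I m (nth_vderiv n f)" for n m
  proof (induction n arbitrary: m)
    case 0
    show ?case using f by simp
  next
    case (Suc n)
    obtain g where g: "\<And>u. u \<in> I \<Longrightarrow> (nth_vderiv n f has_vector_derivative g u) (at u)"
      "diff_times I m g"
      using Suc[of "Suc m"] by auto
    show ?case
      by (rule diff_times_cong[OF I _ g(2)]) (simp add: vector_derivative_at[OF g(1)])
  qed
  have "nth_vderiv n f differentiable (at u)" if "u \<in> I" for n u
    using *[of "Suc 0" n] that
    by (auto simp: has_vector_derivative_def differentiable_def)
  with I show "smooth_on_open I f" by (simp add: smooth_on_open_def)
qed

lemma diff_times_SucD: "diff_times I (Suc n) f \<Longrightarrow> diff_times I n f"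
proof (induction n arbitrary: f)
  case (Suc n)
  then show ?case unfolding diff_times.simps(2)[of _ "Suc n"] diff_times.simps(2)[of _ n] by blast
qed simp

lemma diff_times_SucI:
  assumes "\<And>u. u \<in> I \<Longrightarrow> (f has_vector_derivative f' u) (at u)" "diff_times I n f'"
  shows "diff_times I (Suc n) f"
  using assms by auto

lemma diff_times_SucI_real:
  assumes "\<And>u. u \<in> I \<Longrightarrow> (f has_real_derivative f' u) (at u)" "diff_times I n f'"
  shows "diff_times I (Suc n) f"
  using assms by (intro diff_times_SucI) (auto simp: has_real_derivative_iff_has_vector_derivative)

lemma diff_times_SucE:
  assumes "diff_times I (Suc n) f"
  obtains f' where "\<And>u. u \<in> I \<Longrightarrow> (f has_vector_derivative f' u) (at u)" "diff_times I n f'"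
  using assms by auto

lemma diff_times_SucE_real:
  assumes "diff_times I (Suc n) f"
  obtains f' where "\<And>u. u \<in> I \<Longrightarrow> (f has_real_derivative f' u) (at u)" "diff_times I n f'"
  using assms by (auto simp: has_real_derivative_iff_has_vector_derivative)

lemma diff_times_const: "diff_times I n (\<lambda>_. c :: 'a::real_normed_vector)"
proof (induction n arbitrary: c)
  case (Suc n)
  show ?case
    by (rule diff_times_SucI[OF has_vector_derivative_const Suc])
qed simp

lemma diff_times_bounded_linear:
  assumes L: "bounded_linear L" and f: "diff_times I n f"
  shows "diff_times I n (\<lambda>u. L (f u))"
  using f
proof (induction n arbitrary: f)
  case (Suc n)
  obtain f' where f': "\<And>u. u \<in> I \<Longrightarrow> (f has_vector_derivative f' u) (at u)" "diff_times I n f'"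
    by (rule diff_times_SucE[OF Suc.prems]) (rule that)
  have der: "((\<lambda>u. L (f u)) has_vector_derivative L (f' u)) (at u)" if "u \<in> I" for u
    by (rule bounded_linear.has_vector_derivative[OF L f'(1)[OF that]])
  show ?case
    by (rule diff_times_SucI[OF der Suc.IH[OF f'(2)]])
qed simp

lemma diff_times_add:
  fixes f g :: "real \<Rightarrow> 'a::real_normed_vector"
  assumes "diff_times I n f" "diff_times I n g"
  shows "diff_times I n (\<lambda>u. f u + g u)"
  using assms
proof (induction n arbitrary: f g)
  case (Suc n)
  obtain f' where f': "\<And>u. u \<in> I \<Longrightarrow> (f has_vector_derivative f' u) (at u)" "diff_times I n f'"
    by (rule diff_times_SucE[OF Suc.prems(1)]) (rule that)
  obtain g' where g': "\<And>u. u \<in> I \<Longrightarrow> (g has_vector_derivative g' u) (at u)" "diff_times I n g'"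
    by (rule diff_times_SucE[OF Suc.prems(2)]) (rule that)
  have der: "((\<lambda>u. f u + g u) has_vector_derivative f' u + g' u) (at u)" if "u \<in> I" for u
    by (rule has_vector_derivative_add[OF f'(1)[OF that] g'(1)[OF that]])
  show ?case
    by (rule diff_times_SucI[OF der Suc.IH[OF f'(2) g'(2)]])
qed simp

lemma diff_times_mult:
  fixes f g :: "real \<Rightarrow> real"
  assumes "diff_times I n f" "diff_times I n g"
  shows "diff_times I n (\<lambda>u. f u * g u)"
  using assms
proof (induction n arbitrary: f g)
  case (Suc n)
  obtain f' where f': "\<And>u. u \<in> I \<Longrightarrow> (f has_real_derivative f' u) (at u)" "diff_times I n f'"
    by (rule diff_times_SucE_real[OF Suc.prems(1)]) (rule that)
  obtain g' where g': "\<And>u. u \<in> I \<Longrightarrow> (g has_real_derivative g' u) (at u)" "diff_times I n g'"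
    by (rule diff_times_SucE_real[OF Suc.prems(2)]) (rule that)
  have "((\<lambda>u. f u * g u) has_real_derivative f' u * g u + g' u * f u) (at u)" if "u \<in> I" for u
    by (rule DERIV_mult[OF f'(1)[OF that] g'(1)[OF that]])
  moreover have "diff_times I n (\<lambda>u. f' u * g u + g' u * f u)"
    by (intro diff_times_add Suc.IH f'(2) g'(2) Suc.prems[THEN diff_times_SucD])
  ultimately show ?case
    by (rule diff_times_SucI_real)
qed simp

lemma diff_times_inverse:
  fixes f :: "real \<Rightarrow> real"
  assumes "diff_times I n f" and nz: "\<And>u. u \<in> I \<Longrightarrow> f u \<noteq> 0"
  shows "diff_times I n (\<lambda>u. inverse (f u))"
  using assms(1)
proof (induction n)
  case (Suc n)
  obtain f' where f': "\<And>u. u \<in> I \<Longrightarrow> (f has_real_derivative f' u) (at u)" "diff_times I n f'"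
    by (rule diff_times_SucE_real[OF Suc.prems]) (rule that)
  have "((\<lambda>u. inverse (f u)) has_real_derivative (- 1) * (f' u * (inverse (f u) * inverse (f u)))) (at u)"
    if "u \<in> I" for u
    using f'(1)[OF that] nz[OF that]
    by (auto intro!: derivative_eq_intros simp: field_simps power2_eq_square)
  moreover have "diff_times I n (\<lambda>u. (- 1) * (f' u * (inverse (f u) * inverse (f u))))"
    by (intro diff_times_mult diff_times_const f'(2) Suc.IH Suc.prems[THEN diff_times_SucD])
  ultimately show ?case
    by (rule diff_times_SucI_real)
qed simp

lemma diff_times_sqrt:
  fixes f :: "real \<Rightarrow> real"
  assumes "diff_times I n f" and pos: "\<And>u. u \<in> I \<Longrightarrow> f u > 0"
  shows "diff_times I n (\<lambda>u. sqrt (f u))"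
  using assms(1)
proof (induction n)
  case (Suc n)
  obtain f' where f': "\<And>u. u \<in> I \<Longrightarrow> (f has_real_derivative f' u) (at u)" "diff_times I n f'"
    by (rule diff_times_SucE_real[OF Suc.prems]) (rule that)
  have "((\<lambda>u. sqrt (f u)) has_real_derivative (1/2) * (f' u * inverse (sqrt (f u)))) (at u)"
    if "u \<in> I" for u
    using DERIV_chain2[OF DERIV_real_sqrt[OF pos[OF that]] f'(1)[OF that]]
    by (simp add: mult_ac)
  moreover have "sqrt (f u) \<noteq> 0" if "u \<in> I" for u
    using pos[OF that] by simp
  then have "diff_times I n (\<lambda>u. (1/2) * (f' u * inverse (sqrt (f u))))"
    by (intro diff_times_mult diff_times_const diff_times_inverse f'(2) Suc.IH
        Suc.prems[THEN diff_times_SucD])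
  ultimately show ?case
    by (rule diff_times_SucI_real)
qed simp

lemma diff_times_compose:
  fixes f g :: "real \<Rightarrow> real"
  assumes "diff_times J n f" "diff_times I n g" and "\<And>u. u \<in> I \<Longrightarrow> g u \<in> J"
  shows "diff_times I n (\<lambda>u. f (g u))"
  using assms(1,2)
proof (induction n arbitrary: f)
  case (Suc n)
  obtain f' where f': "\<And>u. u \<in> J \<Longrightarrow> (f has_real_derivative f' u) (at u)" "diff_times J n f'"
    by (rule diff_times_SucE_real[OF Suc.prems(1)]) (rule that)
  obtain g' where g': "\<And>u. u \<in> I \<Longrightarrow> (g has_real_derivative g' u) (at u)" "diff_times I n g'"
    by (rule diff_times_SucE_real[OF Suc.prems(2)]) (rule that)
  have "((\<lambda>u. f (g u)) has_real_derivative f' (g u) * g' u) (at u)" if "u \<in> I" for u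
    by (rule DERIV_chain2[OF f'(1)[OF assms(3)[OF that]] g'(1)[OF that]])
  moreover have "diff_times I n (\<lambda>u. f' (g u) * g' u)"
    by (rule diff_times_mult[OF Suc.IH[OF f'(2) Suc.prems(2)[THEN diff_times_SucD]] g'(2)])
  ultimately show ?case
    by (rule diff_times_SucI_real)
qed simp

lemma smooth_onI:
  assumes "open I" "\<And>n. diff_times I n f"
  shows "smooth_on_open I f"
  using smooth_iff_diff_times[OF assms(1)] assms(2) by blast

lemma smooth_open: "smooth_on_open I f \<Longrightarrow> open I"
  unfolding smooth_on_open_def by (rule conjunct1)

lemma smooth_diff_times:
  assumes "smooth_on_open I f"
  shows "diff_times I n f"
  using smooth_iff_diff_times[OF smooth_open[OF assms]] assms by blast

lemma smooth_const: "open I \<Longrightarrow> smooth_on_open I (\<lambda>_. c :: real)"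
  by (intro smooth_onI diff_times_const)

lemma smooth_ident:
  assumes "open I"
  shows "smooth_on_open I (\<lambda>u::real. u)"
proof (rule smooth_onI[OF assms])
  show "diff_times I n (\<lambda>u::real. u)" for n
  proof (cases n)
    case (Suc m)
    show ?thesis
      unfolding Suc by (rule diff_times_SucI_real[OF DERIV_ident diff_times_const])
  qed simp
qed

lemma smooth_add:
  fixes f g :: "real \<Rightarrow> real"
  assumes f: "smooth_on_open I f" and g: "smooth_on_open I g"
  shows "smooth_on_open I (\<lambda>u. f u + g u)"
  by (rule smooth_onI[OF smooth_open[OF f]
        diff_times_add[OF smooth_diff_times[OF f] smooth_diff_times[OF g]]])

lemma smooth_mult:
  fixes f g :: "real \<Rightarrow> real"
  assumes f: "smooth_on_open I f" and g: "smooth_on_open I g"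
  shows "smooth_on_open I (\<lambda>u. f u * g u)"
  by (rule smooth_onI[OF smooth_open[OF f]
        diff_times_mult[OF smooth_diff_times[OF f] smooth_diff_times[OF g]]])

lemma smooth_power:
  fixes f :: "real \<Rightarrow> real"
  assumes "smooth_on_open I f"
  shows "smooth_on_open I (\<lambda>u. f u ^ k)"
proof (induction k)
  case 0
  show ?case using smooth_const[OF smooth_open[OF assms]] by simp
next
  case (Suc k)
  show ?case using smooth_mult[OF assms Suc] by simp
qed

lemma smooth_inverse:
  fixes f :: "real \<Rightarrow> real"
  assumes "smooth_on_open I f" "\<And>u. u \<in> I \<Longrightarrow> f u \<noteq> 0"
  shows "smooth_on_open I (\<lambda>u. inverse (f u))"
  by (rule smooth_onI[OF smooth_open[OF assms(1)]
        diff_times_inverse[OF smooth_diff_times[OF assms(1)] assms(2)]])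

lemma smooth_sqrt:
  fixes f :: "real \<Rightarrow> real"
  assumes "smooth_on_open I f" "\<And>u. u \<in> I \<Longrightarrow> f u > 0"
  shows "smooth_on_open I (\<lambda>u. sqrt (f u))"
  by (rule smooth_onI[OF smooth_open[OF assms(1)]
        diff_times_sqrt[OF smooth_diff_times[OF assms(1)] assms(2)]])

lemma smooth_of_derivative:
  fixes f :: "real \<Rightarrow> real"
  assumes f': "smooth_on_open I f'" "\<And>u. u \<in> I \<Longrightarrow> (f has_real_derivative f' u) (at u)"
  shows "smooth_on_open I f"
proof (rule smooth_onI[OF smooth_open[OF f'(1)]])
  show "diff_times I n f" for n
  proof (cases n)
    case (Suc m)
    show ?thesis
      unfolding Suc by (rule diff_times_SucI_real[OF f'(2) smooth_diff_times[OF f'(1)]])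
  qed simp
qed

lemma smooth_exp: "smooth_on_open UNIV (\<lambda>u::real. exp u)"
proof (rule smooth_onI[OF open_UNIV])
  show "diff_times UNIV n (\<lambda>u::real. exp u)" for n
  proof (induction n)
    case (Suc n)
    show ?case
      by (rule diff_times_SucI_real[OF DERIV_exp Suc])
  qed simp
qed

text \<open>Kept as constants, so that the simplifier does not rewrite the numerals \<open>1\<close> and \<open>2\<close> in
  the number of derivatives.\<close>

  

definition d1 :: "(real \<Rightarrow> real) \<Rightarrow> real \<Rightarrow> real" where "d1 f = nth_vderiv 1 f"
definition d2 :: "(real \<Rightarrow> real) \<Rightarrow> real \<Rightarrow> real" where "d2 f = nth_vderiv 2 f"

lemma nth_vderiv_Suc_has_derivative:
  assumes "smooth_on_open I f" "u \<in> I"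
  shows "(nth_vderiv n f has_vector_derivative nth_vderiv (Suc n) f u) (at u)"
  using assms by (auto simp: smooth_on_open_def vector_derivative_works)

lemma has_derivative_d1:
  assumes "smooth_on_open I f" "u \<in> I"
  shows "(f has_real_derivative d1 f u) (at u)"
  using nth_vderiv_Suc_has_derivative[OF assms, of 0]
  by (simp add: has_real_derivative_iff_has_vector_derivative d1_def)

lemma has_derivative_d2:
  assumes "smooth_on_open I f" "u \<in> I"
  shows "(d1 f has_real_derivative d2 f u) (at u)"
  using nth_vderiv_Suc_has_derivative[OF assms, of 1]
  by (simp add: has_real_derivative_iff_has_vector_derivative numeral_2_eq_2 d1_def d2_def)

lemma d1_unique: "(f has_real_derivative D) (at u) \<Longrightarrow> d1 f u = D"
  by (simp add: has_real_derivative_iff_has_vector_derivative vector_derivative_at d1_def)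

lemma d2_unique:
  assumes "open I" "u \<in> I" "\<And>t. t \<in> I \<Longrightarrow> (f has_real_derivative f' t) (at t)"
    "(f' has_real_derivative D) (at u)"
  shows "d2 f u = D"
proof -
  have "(d1 f has_real_derivative D) (at u)"
    by (rule has_field_derivative_transform_within_open[OF assms(4,1,2)])
      (rule d1_unique[OF assms(3), symmetric])
  then show ?thesis
    by (simp add: has_real_derivative_iff_has_vector_derivative vector_derivative_at numeral_2_eq_2 d1_def d2_def)
qed

lemma smooth_d1:
  assumes "smooth_on_open I f"
  shows "smooth_on_open I (d1 f)"
proof -
  have "nth_vderiv n (d1 f) = nth_vderiv (Suc n) f" for n
    by (induction n) (auto simp: d1_def)
  with assms show ?thesis by (simp add: smooth_on_open_def del: nth_vderiv.simps(2))
qed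

lemma smooth_compose:
  fixes f g :: "real \<Rightarrow> real"
  assumes "smooth_on_open J f" "smooth_on_open I g" "\<And>u. u \<in> I \<Longrightarrow> g u \<in> J"
  shows "smooth_on_open I (\<lambda>u. f (g u))"
  by (rule smooth_onI[OF smooth_open[OF assms(2)]])
    (rule diff_times_compose[OF smooth_diff_times[OF assms(1)] smooth_diff_times[OF assms(2)] assms(3)])

lemma inj_on_of_derivative_nonzero:
  fixes f :: "real \<Rightarrow> real"
  assumes I: "is_interval I"
    and der: "\<And>t. t \<in> I \<Longrightarrow> (f has_real_derivative f' t) (at t)"
    and nz: "\<And>t. t \<in> I \<Longrightarrow> f' t \<noteq> 0"
  shows "inj_on f I"
proof -
  have *: False if st: "f s = f t" "s < t" "s \<in> I" "t \<in> I" for s t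
  proof -
    have sub: "{s..t} \<subseteq> I"
      using mem_is_interval_1_I[OF I st(3,4)] by auto
    then have "isCont f r" if "r \<in> {s..t}" for r
      using that by (intro DERIV_isCont[OF der]) blast
    then have "continuous_on {s..t} f"
      by (simp add: continuous_at_imp_continuous_on)
    moreover have "f differentiable (at r)" if "s < r" "r < t" for r
    proof -
      have "r \<in> I" using sub that by auto
      from der[OF this] show ?thesis unfolding real_differentiable_def by (rule exI)
    qed
    ultimately have "\<exists>r. s < r \<and> r < t \<and> DERIV f r :> 0"
      by (rule Rolle[OF st(2,1)])
    then obtain r where r: "s < r" "r < t" "DERIV f r :> 0"
      by (elim exE conjE)
    then have rI: "r \<in> I" using sub by auto
    from DERIV_unique[OF der[OF rI] r(3)] nz[OF rI] show False by simp
  qed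
  show ?thesis
  proof (rule inj_onI)
    show "s = t" if "s \<in> I" "t \<in> I" "f s = f t" for s t
    proof (cases s t rule: linorder_cases)
      case less
      from *[OF that(3) less that(1,2)] show ?thesis ..
    next
      case greater
      from *[OF that(3)[symmetric] greater that(2,1)] show ?thesis ..
    qed
  qed
qed

lemma inv_has_derivative:
  fixes f :: "real \<Rightarrow> real"
  assumes der: "\<And>t. (f has_real_derivative f' t) (at t)" and nz: "\<And>t. f' t \<noteq> 0"
  shows "inj f" "open (range f)" "(inv f has_real_derivative inverse (f' t)) (at (f t))"
proof -
  show inj: "inj f"
    by (rule inj_on_of_derivative_nonzero[of UNIV f f']) (auto simp: assms)
  have cont: "continuous_on UNIV f"
    by (intro continuous_at_imp_continuous_on ballI DERIV_isCont[OF der])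
  show "open (range f)"
    using injective_eq_1d_open_map_UNIV[OF cont] inj by auto
  show "(inv f has_real_derivative inverse (f' t)) (at (f t))"
    unfolding has_field_derivative_def
  proof (rule has_derivative_inverse_strong[OF open_UNIV UNIV_I cont])
    show "inv f (f s) = s" for s by (rule inv_f_f[OF inj])
    show "(f has_derivative (*) (f' t)) (at t)"
      using der[of t] unfolding has_field_derivative_def .
    show "(*) (f' t) \<circ> (*) (inverse (f' t)) = id"
      using nz[of t] by (auto simp: fun_eq_iff)
  qed
qed

text \<open>A bootstrapping argument: the right-hand side of \<open>\<phi>' = Y' / Z'(\<phi>)\<close> is as often
  differentiable as \<open>\<phi>\<close> is, so \<open>\<phi>\<close> is one order better than that.\<close>

  

lemma smooth_factor:
  fixes Y Z \<phi> :: "real \<Rightarrow> real"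
  assumes Z: "smooth_on_open UNIV Z" "\<And>t. d1 Z t \<noteq> 0"
    and Y: "smooth_on_open I Y"
    and eq: "\<And>u. u \<in> I \<Longrightarrow> Y u = Z (\<phi> u)"
  shows "smooth_on_open I \<phi>"
proof -
  have I: "open I" using Y by (simp add: smooth_on_open_def)
  have dZ: "(Z has_real_derivative d1 Z t) (at t)" for t
    by (rule has_derivative_d1[OF Z(1) UNIV_I])
  note inv = inv_has_derivative[of Z "d1 Z", OF dZ Z(2)]
  have \<phi>: "\<phi> u = inv Z (Y u)" if "u \<in> I" for u
    unfolding eq[OF that] by (rule inv_f_f[OF inv(1), symmetric])
  have der: "(\<phi> has_real_derivative inverse (d1 Z (\<phi> u)) * d1 Y u) (at u)" if u: "u \<in> I" for u
  proof (rule has_field_derivative_transform_within_open[OF _ I u])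
    have "(inv Z has_real_derivative inverse (d1 Z (\<phi> u))) (at (Y u))"
      unfolding eq[OF u] by (rule inv(3))
    then show "((\<lambda>u. inv Z (Y u)) has_real_derivative inverse (d1 Z (\<phi> u)) * d1 Y u) (at u)"
      by (rule DERIV_chain2[OF _ has_derivative_d1[OF Y u]])
  qed (simp add: \<phi>)
  have "diff_times I n \<phi>" for n
  proof (induction n)
    case (Suc n)
    have "diff_times I n (\<lambda>u. d1 Z (\<phi> u))"
      by (rule diff_times_compose[OF smooth_diff_times[OF smooth_d1[OF Z(1)]] Suc UNIV_I])
    from diff_times_mult[OF diff_times_inverse[OF this Z(2)] smooth_diff_times[OF smooth_d1[OF Y]]]
    have "diff_times I n (\<lambda>u. inverse (d1 Z (\<phi> u)) * d1 Y u)" .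
    with der show ?case by (rule diff_times_SucI_real)
  qed simp
  with I show ?thesis by (simp add: smooth_iff_diff_times)
qed

lemma d2_eq: "d2 f = d1 (d1 f)"
  by (simp add: d1_def d2_def numeral_2_eq_2)

lemma smooth_continuous:
  assumes "smooth_on_open I f"
  shows "continuous_on I (f :: real \<Rightarrow> real)"
  by (intro continuous_at_imp_continuous_on ballI DERIV_isCont[OF has_derivative_d1[OF assms]])

section \<open>The equation in coordinates\<close>

lemma smooth_vec2_iff:
  fixes Y :: "real \<Rightarrow> real^2"
  shows "smooth_on_open I Y \<longleftrightarrow> smooth_on_open I (\<lambda>u. Y u $ 1) \<and> smooth_on_open I (\<lambda>u. Y u $ 2)"
proof
  assume Y: "smooth_on_open I Y"
  have "smooth_on_open I (\<lambda>u. Y u $ i)" for i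
    by (rule smooth_onI[OF smooth_open[OF Y]
        diff_times_bounded_linear[OF bounded_linear_vec_nth smooth_diff_times[OF Y]]])
  then show "smooth_on_open I (\<lambda>u. Y u $ 1) \<and> smooth_on_open I (\<lambda>u. Y u $ 2)" by blast
next
  assume *: "smooth_on_open I (\<lambda>u. Y u $ 1) \<and> smooth_on_open I (\<lambda>u. Y u $ 2)"
  have lin: "bounded_linear (\<lambda>r. r *\<^sub>R (axis i 1 :: real^2))" for i
    by (rule bounded_linear_scaleR_left)
  have eq: "Y = (\<lambda>u. (Y u $ 1) *\<^sub>R axis 1 1 + (Y u $ 2) *\<^sub>R axis 2 1)"
    by (simp add: fun_eq_iff vec_eq_iff forall_2 axis_def)
  show "smooth_on_open I Y"
    by (subst eq, rule smooth_onI[OF smooth_open[OF conjunct1[OF *]]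
        diff_times_add[OF
          diff_times_bounded_linear[OF lin smooth_diff_times[OF conjunct1[OF *]]]
          diff_times_bounded_linear[OF lin smooth_diff_times[OF conjunct2[OF *]]]]])
qed

lemma nth_vderiv_component:
  fixes Y :: "real \<Rightarrow> real^2"
  assumes Y: "smooth_on_open I Y" and u: "u \<in> I"
  shows "nth_vderiv n Y u $ i = nth_vderiv n (\<lambda>u. Y u $ i) u"
  using u
proof (induction n arbitrary: u)
  case (Suc n)
  have "((\<lambda>u. nth_vderiv n Y u $ i) has_vector_derivative nth_vderiv (Suc n) Y u $ i) (at u)"
    by (rule bounded_linear.has_vector_derivative[OF bounded_linear_vec_nth
          nth_vderiv_Suc_has_derivative[OF Y Suc.prems]])
  then have "(nth_vderiv n (\<lambda>u. Y u $ i) has_vector_derivative nth_vderiv (Suc n) Y u $ i) (at u)"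
    by (rule has_vector_derivative_transform_within_open[OF _ smooth_open[OF Y] Suc.prems Suc.IH])
  then show ?case
    by (simp add: vector_derivative_at)
qed simp

text \<open>Cubing is a bijection of the line, and the cubes of both sides have the denominator
  \<open>norm v ^ 3\<close>. What remains is polynomial in the coordinates and their derivatives.\<close>

  

lemma equation_polynomial:
  fixes p v w :: "real^2"
  assumes v: "v \<noteq> 0"
  shows "((vector [vector [0, 0], vector [0, 1]] :: real^2^2) *v p) \<bullet> (rot *v (v /\<^sub>R norm v))
       = root 3 (det (transpose (vector [v, w] :: real^2^2)) / norm v ^ 3)
     \<longleftrightarrow> v $ 1 * w $ 2 - v $ 2 * w $ 1 = (p $ 2) ^ 3 * (v $ 1) ^ 3"
proof -
  define n where "n = norm v"
  have n: "n \<noteq> 0" using v by (simp add: n_def)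
  have L: "((vector [vector [0, 0], vector [0, 1]] :: real^2^2) *v p) \<bullet> (rot *v (v /\<^sub>R norm v))
    = p $ 2 * v $ 1 / n"
    by (simp add: inner_vec_def sum_2 matrix_vector_mult_def rot_def vector_2 n_def field_simps)
  have R: "det (transpose (vector [v, w] :: real^2^2)) = v $ 1 * w $ 2 - v $ 2 * w $ 1"
    by (simp only: det_transpose) (simp add: det_2 vector_2)
  have "p $ 2 * v $ 1 / n = root 3 ((v $ 1 * w $ 2 - v $ 2 * w $ 1) / n ^ 3)
      \<longleftrightarrow> (p $ 2 * v $ 1 / n) ^ 3 = (v $ 1 * w $ 2 - v $ 2 * w $ 1) / n ^ 3"
    using odd_real_root_pow[of 3 "(v $ 1 * w $ 2 - v $ 2 * w $ 1) / n ^ 3"]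
      odd_real_root_power_cancel[of 3 "p $ 2 * v $ 1 / n"] by force
  also have "\<dots> \<longleftrightarrow> v $ 1 * w $ 2 - v $ 2 * w $ 1 = (p $ 2) ^ 3 * (v $ 1) ^ 3"
    using n by (auto simp: power_divide power_mult_distrib)
  finally show ?thesis
    unfolding L R n_def .
qed

definition plane_solution :: "real set \<Rightarrow> (real \<Rightarrow> real) \<Rightarrow> (real \<Rightarrow> real) \<Rightarrow> bool" where
  "plane_solution I x y \<longleftrightarrow> open_interval I \<and> smooth_on_open I x \<and> smooth_on_open I y
     \<and> (\<forall>u\<in>I. d1 x u \<noteq> 0 \<or> d1 y u \<noteq> 0)
     \<and> (\<forall>u\<in>I. d1 x u * d2 y u - d1 y u * d2 x u = y u ^ 3 * d1 x u ^ 3)"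

lemma d1_component: "smooth_on_open I Y \<Longrightarrow> u \<in> I \<Longrightarrow> nth_vderiv 1 Y u $ i = d1 (\<lambda>u. Y u $ i) u"
  for Y :: "real \<Rightarrow> real^2"
  unfolding d1_def by (rule nth_vderiv_component)

lemma d2_component: "smooth_on_open I Y \<Longrightarrow> u \<in> I \<Longrightarrow> nth_vderiv 2 Y u $ i = d2 (\<lambda>u. Y u $ i) u"
  for Y :: "real \<Rightarrow> real^2"
  unfolding d2_def by (rule nth_vderiv_component)

lemma immersed_curve_iff:
  "immersed_curve I Y \<longleftrightarrow> open_interval I \<and> smooth_on_open I (\<lambda>u. Y u $ 1)
     \<and> smooth_on_open I (\<lambda>u. Y u $ 2)
     \<and> (\<forall>u\<in>I. d1 (\<lambda>u. Y u $ 1) u \<noteq> 0 \<or> d1 (\<lambda>u. Y u $ 2) u \<noteq> 0)"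
proof -
  have "nth_vderiv 1 Y u \<noteq> 0 \<longleftrightarrow> d1 (\<lambda>u. Y u $ 1) u \<noteq> 0 \<or> d1 (\<lambda>u. Y u $ 2) u \<noteq> 0"
    if "smooth_on_open I Y" "u \<in> I" for u
    unfolding vec_eq_iff forall_2 d1_component[OF that] zero_index by blast
  then show ?thesis
    using smooth_vec2_iff[of I Y] unfolding immersed_curve_def by blast
qed

lemma solution_iff: "solution I Y \<longleftrightarrow> plane_solution I (\<lambda>u. Y u $ 1) (\<lambda>u. Y u $ 2)"
proof -
  have "((vector [vector [0, 0], vector [0, 1]] :: real^2^2) *v Y u) \<bullet> normal_vec Y u
          = root 3 (curvature Y u)
        \<longleftrightarrow> d1 (\<lambda>u. Y u $ 1) u * d2 (\<lambda>u. Y u $ 2) u - d1 (\<lambda>u. Y u $ 2) u * d2 (\<lambda>u. Y u $ 1) u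
          = Y u $ 2 ^ 3 * d1 (\<lambda>u. Y u $ 1) u ^ 3"
    if Y: "immersed_curve I Y" and u: "u \<in> I" for u
  proof -
    have s: "smooth_on_open I Y" and nz: "nth_vderiv 1 Y u \<noteq> 0"
      using Y u unfolding immersed_curve_def by blast+
    show ?thesis
      unfolding normal_vec_def tangent_def curvature_def equation_polynomial[OF nz]
        d1_component[OF s u] d2_component[OF s u] ..
  qed
  then show ?thesis
    unfolding solution_def plane_solution_def immersed_curve_iff by blast
qed

section \<open>Solutions are vertical lines or graphs\<close>

text \<open>Multiplied by the integrating factor \<open>exp (- g)\<close>, where \<open>g' = b\<close>, the function \<open>p\<close>
  becomes constant.\<close>

  

lemma linear_ode_zero:
  fixes p b :: "real \<Rightarrow> real"
  assumes I: "is_interval I"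
    and der: "\<And>u. u \<in> I \<Longrightarrow> (p has_real_derivative b u * p u) (at u)"
    and b: "continuous_on I b"
    and u0: "u0 \<in> I" "p u0 = 0" and u: "u \<in> I"
  shows "p u = 0"
proof -
  define c d where "c = min u0 u" and "d = max u0 u"
  have cdI: "c \<in> I" "d \<in> I" using u0 u by (auto simp: c_def d_def min_def max_def)
  have sub: "{c..d} \<subseteq> I"
    using mem_is_interval_1_I[OF I cdI] by auto
  obtain g where g: "\<And>t. t \<in> {c..d} \<Longrightarrow> (g has_vector_derivative b t) (at t within {c..d})"
    using antiderivative_continuous[OF continuous_on_subset[OF b sub]] by blast
  have "((\<lambda>t. p t * exp (- g t)) has_real_derivative 0) (at t within {c..d})" if t: "t \<in> {c..d}" for t
  proof -
    have 1: "(g has_real_derivative b t) (at t within {c..d})"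
      using g[OF t] by (simp add: has_real_derivative_iff_has_vector_derivative)
    have 2: "(p has_real_derivative b t * p t) (at t within {c..d})"
      by (rule has_field_derivative_at_within[OF der]) (use sub t in blast)
    show ?thesis
      by (rule derivative_eq_intros 1 2 refl)+ (simp add: algebra_simps)
  qed
  then obtain K where K: "\<And>t. t \<in> {c..d} \<Longrightarrow> p t * exp (- g t) = K"
    using has_field_derivative_zero_constant[of "{c..d}" "\<lambda>t. p t * exp (- g t)"] by blast
  have "u0 \<in> {c..d}" "u \<in> {c..d}" by (auto simp: c_def d_def)
  with K[of u0] K[of u] u0 show ?thesis by simp
qed

lemma plane_solutionD:
  assumes "plane_solution I x y"
  shows "open_interval I" "is_interval I" "open I" "I \<noteq> {}" "smooth_on_open I x" "smooth_on_open I y"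
    "\<And>u. u \<in> I \<Longrightarrow> d1 x u \<noteq> 0 \<or> d1 y u \<noteq> 0"
    "\<And>u. u \<in> I \<Longrightarrow> d1 x u * d2 y u - d1 y u * d2 x u = y u ^ 3 * d1 x u ^ 3"
  using assms unfolding plane_solution_def open_interval_def by auto

text \<open>The equation is homogeneous linear in \<open>x'\<close>: solved for \<open>x''\<close> it reads \<open>x'' = b x'\<close>
  with \<open>b\<close> as below. The denominator of \<open>b\<close> is the squared speed, so \<open>b\<close> is continuous also
  where the tangent is vertical or horizontal.\<close>

  

lemma vertical_or_graph:
  assumes sol: "plane_solution I x y"
  shows "(\<forall>u\<in>I. d1 x u = 0) \<or> (\<forall>u\<in>I. d1 x u \<noteq> 0)"
proof -
  note D = plane_solutionD[OF sol]
  note cont = smooth_continuous[OF D(6)] smooth_continuous[OF smooth_d1[OF D(5)]]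
    smooth_continuous[OF smooth_d1[OF D(6)]] smooth_continuous[OF smooth_d1[OF smooth_d1[OF D(5)]]]
    smooth_continuous[OF smooth_d1[OF smooth_d1[OF D(6)]]]
  define b where "b = (\<lambda>u. (d1 x u * d2 x u + d1 y u * d2 y u - d1 y u * y u ^ 3 * d1 x u ^ 2)
    / (d1 x u ^ 2 + d1 y u ^ 2))"
  have pos: "d1 x u ^ 2 + d1 y u ^ 2 \<noteq> 0" if "u \<in> I" for u
    using D(7)[OF that] by (simp add: sum_power2_eq_zero_iff)
  have "continuous_on I b"
    unfolding b_def d2_eq by (intro continuous_intros cont ballI pos)
  moreover have "(d1 x has_real_derivative b u * d1 x u) (at u)" if u: "u \<in> I" for u
  proof -
    have "d2 x u * (d1 x u ^ 2 + d1 y u ^ 2)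
        = d1 x u * (d1 x u * d2 x u + d1 y u * d2 y u - d1 y u * y u ^ 3 * d1 x u ^ 2)"
      using D(8)[OF u] by algebra
    then have "d2 x u = b u * d1 x u"
      using pos[OF u] unfolding b_def by (simp add: nonzero_eq_divide_eq mult.commute)
    with has_derivative_d2[OF D(5) u] show ?thesis by simp
  qed
  ultimately have "d1 x u = 0" if "u \<in> I" "u0 \<in> I" "d1 x u0 = 0" for u u0
    using linear_ode_zero[OF D(2), of "d1 x" b u0 u] that by blast
  then show ?thesis by blast
qed

text \<open>One fixed coordinate has a derivative without zeros, so a solution can neither close
  up nor cross itself.\<close>

  

lemma plane_solution_inj_coordinate:
  assumes sol: "plane_solution I x y"
  shows "(\<forall>u\<in>I. d1 x u \<noteq> 0) \<and> inj_on x I \<or> (\<forall>u\<in>I. d1 y u \<noteq> 0) \<and> inj_on y I"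
proof -
  note D = plane_solutionD[OF sol]
  from vertical_or_graph[OF sol] show ?thesis
  proof
    assume "\<forall>u\<in>I. d1 x u = 0"
    then have nz: "\<And>u. u \<in> I \<Longrightarrow> d1 y u \<noteq> 0" using D(7) by blast
    with inj_on_of_derivative_nonzero[OF D(2) has_derivative_d1[OF D(6)] nz] show ?thesis by blast
  next
    assume "\<forall>u\<in>I. d1 x u \<noteq> 0"
    then have nz: "\<And>u. u \<in> I \<Longrightarrow> d1 x u \<noteq> 0" by blast
    with inj_on_of_derivative_nonzero[OF D(2) has_derivative_d1[OF D(5)] nz] show ?thesis by blast
  qed
qed

lemma solution_inj:
  assumes "solution I Y"
  shows "inj_on Y I"
  using plane_solution_inj_coordinate[OF assms[unfolded solution_iff]]
proof (elim disjE conjE)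
  assume *: "inj_on (\<lambda>u. Y u $ 1) I"
  show ?thesis by (rule inj_onI) (rule inj_onD[OF *], simp_all)
next
  assume *: "inj_on (\<lambda>u. Y u $ 2) I"
  show ?thesis by (rule inj_onI) (rule inj_onD[OF *], simp_all)
qed

section \<open>Complete solution curves\<close>

text \<open>A solution defined for all parameter values whose image is a closed subset of the
  plane. Closedness is what replaces the study of blow-up times: it prevents the curve from
  having an end point at which it could be continued.\<close>

  

definition complete_solution :: "(real \<Rightarrow> real) \<Rightarrow> (real \<Rightarrow> real) \<Rightarrow> (real^2) set \<Rightarrow> bool" where
  "complete_solution X Z S \<longleftrightarrow> plane_solution UNIV X Z \<and> closed S
     \<and> range (\<lambda>t. vector [X t, Z t]) = S"

lemma vec2_eq_iff: "p = (vector [a, b] :: real^2) \<longleftrightarrow> p $ 1 = a \<and> p $ 2 = b"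
  by (simp add: vec_eq_iff forall_2 vector_2)

lemma chain_d1:
  assumes I: "open I" "u \<in> I" and X: "smooth_on_open UNIV X" and \<phi>: "smooth_on_open I \<phi>"
    and eq: "\<And>u. u \<in> I \<Longrightarrow> x u = X (\<phi> u)"
  shows "d1 x u = d1 X (\<phi> u) * d1 \<phi> u"
proof (rule d1_unique, rule has_field_derivative_transform_within_open[OF _ I])
  show "((\<lambda>u. X (\<phi> u)) has_real_derivative d1 X (\<phi> u) * d1 \<phi> u) (at u)"
    by (rule DERIV_chain2[OF has_derivative_d1[OF X UNIV_I] has_derivative_d1[OF \<phi> I(2)]])
qed (rule eq[symmetric])

lemma chain_d2:
  assumes I: "open I" "u \<in> I" and X: "smooth_on_open UNIV X" and \<phi>: "smooth_on_open I \<phi>"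
    and eq: "\<And>u. u \<in> I \<Longrightarrow> x u = X (\<phi> u)"
  shows "d2 x u = d2 X (\<phi> u) * d1 \<phi> u ^ 2 + d1 X (\<phi> u) * d2 \<phi> u"
  unfolding d2_eq[of x]
proof (rule d1_unique, rule has_field_derivative_transform_within_open[OF _ I])
  have "((\<lambda>u. d1 X (\<phi> u)) has_real_derivative d2 X (\<phi> u) * d1 \<phi> u) (at u)"
    by (rule DERIV_chain2[OF has_derivative_d2[OF X UNIV_I] has_derivative_d1[OF \<phi> I(2)]])
  from DERIV_mult[OF this has_derivative_d2[OF \<phi> I(2)]]
  show "((\<lambda>u. d1 X (\<phi> u) * d1 \<phi> u) has_real_derivative
      d2 X (\<phi> u) * d1 \<phi> u ^ 2 + d1 X (\<phi> u) * d2 \<phi> u) (at u)"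
    by (simp add: power2_eq_square mult_ac)
  show "d1 X (\<phi> t) * d1 \<phi> t = d1 x t" if "t \<in> I" for t
    by (rule chain_d1[OF I(1) that X \<phi> eq, symmetric])
qed

text \<open>The parameter change is the inverse of the coordinate of \<open>(X, Z)\<close> that has a
  derivative without zeros, applied to the same coordinate of \<open>Y\<close>.\<close>

  

lemma factor_through_complete_solution:
  assumes S: "complete_solution X Z S" and Y: "immersed_curve I Y" and sub: "Y ` I \<subseteq> S"
  shows "\<exists>\<phi>. smooth_on_open I \<phi> \<and> (\<forall>u\<in>I. d1 \<phi> u \<noteq> 0 \<and> Y u = vector [X (\<phi> u), Z (\<phi> u)])"
proof -
  have sol: "plane_solution UNIV X Z" using S by (simp add: complete_solution_def)
  note D = plane_solutionD[OF sol]
  have I: "open I" and s1: "smooth_on_open I (\<lambda>u. Y u $ 1)" and s2: "smooth_on_open I (\<lambda>u. Y u $ 2)"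
    and nz: "\<And>u. u \<in> I \<Longrightarrow> d1 (\<lambda>u. Y u $ 1) u \<noteq> 0 \<or> d1 (\<lambda>u. Y u $ 2) u \<noteq> 0"
    using Y unfolding immersed_curve_iff open_interval_def by blast+
  have "\<exists>t. Y u = vector [X t, Z t]" if "u \<in> I" for u
    using S sub that unfolding complete_solution_def by blast
  then obtain \<phi> where \<phi>: "\<And>u. u \<in> I \<Longrightarrow> Y u = vector [X (\<phi> u), Z (\<phi> u)]"
    by metis
  have e1: "Y u $ 1 = X (\<phi> u)" and e2: "Y u $ 2 = Z (\<phi> u)" if "u \<in> I" for u
    using \<phi>[OF that] by (simp_all add: vector_2)
  have sm: "smooth_on_open I \<phi>"
    using plane_solution_inj_coordinate[OF sol]
  proof (elim disjE conjE)
    assume "\<forall>t\<in>UNIV. d1 X t \<noteq> 0"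
    then have "\<And>t. d1 X t \<noteq> 0" by blast
    from smooth_factor[OF D(5) this s1 e1] show ?thesis .
  next
    assume "\<forall>t\<in>UNIV. d1 Z t \<noteq> 0"
    then have "\<And>t. d1 Z t \<noteq> 0" by blast
    from smooth_factor[OF D(6) this s2 e2] show ?thesis .
  qed
  have "d1 \<phi> u \<noteq> 0" if u: "u \<in> I" for u
    using nz[OF u] chain_d1[OF I u D(5) sm e1] chain_d1[OF I u D(6) sm e2] by auto
  with sm \<phi> show ?thesis by blast
qed

text \<open>Under a parameter change both sides of the polynomial equation are multiplied by
  \<open>(\<phi>')\<^sup>3\<close>; the terms with \<open>\<phi>''\<close> cancel in the determinant.\<close>

  

lemma reparam_of_solution:
  assumes sol: "plane_solution UNIV X Z" and I: "open_interval I" and \<phi>: "smooth_on_open I \<phi>"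
    and nz: "\<And>u. u \<in> I \<Longrightarrow> d1 \<phi> u \<noteq> 0"
    and x: "\<And>u. u \<in> I \<Longrightarrow> x u = X (\<phi> u)" and y: "\<And>u. u \<in> I \<Longrightarrow> y u = Z (\<phi> u)"
    and sm: "smooth_on_open I x" "smooth_on_open I y"
  shows "plane_solution I x y"
proof -
  note D = plane_solutionD[OF sol]
  have oI: "open I" using I by (simp add: open_interval_def)
  have c1: "d1 x u = d1 X (\<phi> u) * d1 \<phi> u" "d1 y u = d1 Z (\<phi> u) * d1 \<phi> u" if u: "u \<in> I" for u
    by (rule chain_d1[OF oI u D(5) \<phi> x], assumption) (rule chain_d1[OF oI u D(6) \<phi> y])
  have c2: "d2 x u = d2 X (\<phi> u) * d1 \<phi> u ^ 2 + d1 X (\<phi> u) * d2 \<phi> u"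
    "d2 y u = d2 Z (\<phi> u) * d1 \<phi> u ^ 2 + d1 Z (\<phi> u) * d2 \<phi> u" if u: "u \<in> I" for u
    by (rule chain_d2[OF oI u D(5) \<phi> x], assumption) (rule chain_d2[OF oI u D(6) \<phi> y])
  have reg: "d1 x u \<noteq> 0 \<or> d1 y u \<noteq> 0" if u: "u \<in> I" for u
    using D(7)[of "\<phi> u"] nz[OF u] unfolding c1[OF u] by simp
  have eqn: "d1 x u * d2 y u - d1 y u * d2 x u = y u ^ 3 * d1 x u ^ 3" if u: "u \<in> I" for u
    using D(8)[of "\<phi> u", OF UNIV_I]
    unfolding c1[OF u] c2[OF u] y[OF u] by algebra
  show ?thesis
    unfolding plane_solution_def using I sm reg eqn by blast
qed

lemma solution_of_plane_solution:
  assumes "plane_solution I X Z"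
  shows "solution I (\<lambda>t. vector [X t, Z t])"
  using assms by (simp add: solution_iff vector_2)

lemma complete_solution_parametrizes:
  assumes "complete_solution X Z S"
  shows "parametrizes UNIV (\<lambda>t. vector [X t, Z t]) S"
proof -
  have "plane_solution UNIV X Z" using assms by (simp add: complete_solution_def)
  from solution_of_plane_solution[OF this] solution_inj[OF this[THEN solution_of_plane_solution]]
  show ?thesis
    using assms by (simp add: parametrizes_def solution_def complete_solution_def)
qed

text \<open>Let \<open>W\<close> be a solution that extends \<open>Y\<close> by way of \<open>\<psi>\<close>. Since \<open>W\<close> is injective, \<open>\<psi> ` I\<close>
  is the whole preimage of \<open>S\<close> under \<open>W\<close>, hence closed in the domain of \<open>W\<close>. It is also
  open, and the domain is connected.\<close>

  

lemma parametrization_maximal: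
  assumes S: "complete_solution X Z S" and Y: "parametrizes I Y S"
  shows "maximal_solution I Y"
proof -
  have imm: "immersed_curve I Y" and inj: "inj_on Y I" and img: "Y ` I = S"
    using Y by (auto simp: parametrizes_def)
  have sol: "plane_solution UNIV X Z" and cl: "closed S"
    using S by (auto simp: complete_solution_def)
  have I: "open_interval I" "smooth_on_open I (\<lambda>u. Y u $ 1)" "smooth_on_open I (\<lambda>u. Y u $ 2)"
    using imm unfolding immersed_curve_iff by blast+
  obtain \<phi> where \<phi>: "smooth_on_open I \<phi>" "\<And>u. u \<in> I \<Longrightarrow> d1 \<phi> u \<noteq> 0"
    "\<And>u. u \<in> I \<Longrightarrow> Y u = vector [X (\<phi> u), Z (\<phi> u)]"
    using factor_through_complete_solution[OF S imm] img by blast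
  have comp: "Y u $ 1 = X (\<phi> u)" "Y u $ 2 = Z (\<phi> u)" if "u \<in> I" for u
    using \<phi>(3)[OF that] by (simp_all add: vector_2)
  have solY: "solution I Y"
    unfolding solution_iff
    by (rule reparam_of_solution[OF sol I(1) \<phi>(1,2) comp I(2,3)])
  have "\<psi> ` I = J" if W: "solution J W" and r: "reparam_into \<psi> I Y J W" for J W \<psi>
  proof -
    note injW = solution_inj[OF W]
    have J: "connected J" "open J"
      using W by (auto simp: solution_def immersed_curve_def open_interval_def is_interval_connected)
    have \<psi>: "smooth_on_open I \<psi>" "\<And>u. u \<in> I \<Longrightarrow> \<psi> u \<in> J" "\<And>u. u \<in> I \<Longrightarrow> Y u = W (\<psi> u)"
      using r by (auto simp: reparam_into_def)
    have I': "open I" "is_interval I" "I \<noteq> {}"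
      using I(1) by (auto simp: open_interval_def)
    have "inj_on \<psi> I"
    proof (rule inj_onI)
      show "s = t" if "s \<in> I" "t \<in> I" "\<psi> s = \<psi> t" for s t
        using inj_onD[OF inj _ that(1,2)] \<psi>(3)[OF that(1)] \<psi>(3)[OF that(2)] that(3) by simp
    qed
    then have op: "open (\<psi> ` I)"
      using injective_eq_1d_open_map_UNIV[OF smooth_continuous[OF \<psi>(1)] I'(2)] I'(1) by blast
    have contW: "continuous_on J W"
    proof (rule continuous_at_imp_continuous_on, rule ballI)
      show "isCont W t" if "t \<in> J" for t
        using W that unfolding solution_def immersed_curve_def smooth_on_open_def
        by (metis nth_vderiv.simps(1) differentiable_imp_continuous_within)
    qed
    have "t \<in> \<psi> ` I" if t: "t \<in> J" "W t \<in> S" for t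
    proof -
      obtain u where u: "u \<in> I" "W t = Y u" using t(2) img by blast
      with inj_onD[OF injW _ t(1) \<psi>(2)[OF u(1)]] \<psi>(3)[OF u(1)] have "t = \<psi> u" by simp
      with u(1) show ?thesis by blast
    qed
    moreover have "\<psi> u \<in> J \<inter> W -` S" if "u \<in> I" for u
      using \<psi>(2)[OF that] \<psi>(3)[OF that, symmetric] imageI[OF that, of Y] img by simp
    ultimately have eq: "\<psi> ` I = J \<inter> W -` S" by blast
    have "closedin (top_of_set J) (\<psi> ` I)"
      unfolding eq by (rule continuous_closedin_preimage[OF contW cl])
    moreover have "openin (top_of_set J) (\<psi> ` I)"
      using op \<psi>(2) by (intro open_openin_trans) (auto simp: J(2))
    ultimately have "\<psi> ` I = {} \<or> \<psi> ` I = J"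
      using J(1) unfolding connected_clopen by blast
    with I'(3) show ?thesis by blast
  qed
  with solY show ?thesis unfolding maximal_solution_def by blast
qed

text \<open>A solution inside \<open>S\<close> is a reparametrized part of the complete solution with image
  \<open>S\<close>; by maximality it is all of it.\<close>

  

lemma maximal_solution_onto:
  assumes S: "complete_solution X Z S" and Y: "maximal_solution I Y" and sub: "Y ` I \<subseteq> S"
  shows "parametrizes I Y S"
proof -
  have solY: "solution I Y" and imm: "immersed_curve I Y"
    using Y by (auto simp: maximal_solution_def solution_def)
  have sol: "plane_solution UNIV X Z" and rng: "range (\<lambda>t. vector [X t, Z t]) = S"
    using S by (auto simp: complete_solution_def)
  obtain \<phi> where \<phi>: "smooth_on_open I \<phi>" "\<And>u. u \<in> I \<Longrightarrow> d1 \<phi> u \<noteq> 0"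
    "\<And>u. u \<in> I \<Longrightarrow> Y u = vector [X (\<phi> u), Z (\<phi> u)]"
    using factor_through_complete_solution[OF S imm sub] by blast
  have "reparam_into \<phi> I Y UNIV (\<lambda>t. vector [X t, Z t])"
    using \<phi> unfolding reparam_into_def d1_def by blast
  with Y solution_of_plane_solution[OF sol] have onto: "\<phi> ` I = UNIV"
    unfolding maximal_solution_def by blast
  have "Y ` I = (\<lambda>t. vector [X t, Z t]) ` \<phi> ` I"
    unfolding image_image by (rule image_cong[OF refl \<phi>(3)])
  then have "Y ` I = S" unfolding onto rng .
  with imm solution_inj[OF solY] show ?thesis
    unfolding parametrizes_def by blast
qed

section \<open>Standard parametrizations of the classified curves\<close>

lemma complete_solutionI:
  assumes X: "smooth_on_open UNIV X" "\<And>t. (X has_real_derivative X1 t) (at t)"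
      "\<And>t. (X1 has_real_derivative X2 t) (at t)"
    and Z: "smooth_on_open UNIV Z" "\<And>t. (Z has_real_derivative Z1 t) (at t)"
      "\<And>t. (Z1 has_real_derivative Z2 t) (at t)"
    and reg: "\<And>t. X1 t \<noteq> 0 \<or> Z1 t \<noteq> 0"
    and eqn: "\<And>t. X1 t * Z2 t - Z1 t * X2 t = Z t ^ 3 * X1 t ^ 3"
    and S: "closed S" "\<And>p. p \<in> S \<longleftrightarrow> (\<exists>t. p $ 1 = X t \<and> p $ 2 = Z t)"
  shows "complete_solution X Z S"
proof -
  have d: "d1 X t = X1 t" "d1 Z t = Z1 t" "d2 X t = X2 t" "d2 Z t = Z2 t" for t
    using d1_unique[OF X(2)] d1_unique[OF Z(2)] d2_unique[OF open_UNIV UNIV_I X(2) X(3)]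
      d2_unique[OF open_UNIV UNIV_I Z(2) Z(3)] by blast+
  have "open_interval UNIV" by (simp add: open_interval_def)
  then have "plane_solution UNIV X Z"
    unfolding plane_solution_def d using X(1) Z(1) reg eqn by blast
  moreover have "range (\<lambda>t. vector [X t, Z t]) = S"
    using S(2) by (auto simp: image_iff vec2_eq_iff)
  ultimately show ?thesis unfolding complete_solution_def using S(1) by blast
qed

lemma complete_vertical_line: "complete_solution (\<lambda>_. C) (\<lambda>t. t) (vertical_line C)"
proof (rule complete_solutionI[where ?X1.0 = "\<lambda>_. 0" and ?X2.0 = "\<lambda>_. 0" and ?Z1.0 = "\<lambda>_. 1" and ?Z2.0 = "\<lambda>_. 0"])
  show "closed (vertical_line C)"
    unfolding vertical_line_def by (intro closed_Collect_eq continuous_intros)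
qed (auto simp: vertical_line_def smooth_const smooth_ident)

lemma complete_x_axis: "complete_solution (\<lambda>t. t) (\<lambda>_. 0) x_axis"
proof (rule complete_solutionI[where ?X1.0 = "\<lambda>_. 1" and ?X2.0 = "\<lambda>_. 0" and ?Z1.0 = "\<lambda>_. 0" and ?Z2.0 = "\<lambda>_. 0"])
  show "closed x_axis"
    unfolding x_axis_def by (intro closed_Collect_eq continuous_intros)
qed (auto simp: x_axis_def smooth_const smooth_ident)

text \<open>The sign \<open>r\<close> selects the hyperbola, the sign \<open>s\<close> its branch. The condition on \<open>s\<close> is
  the weak inequality, which makes closedness evident; for \<open>r = 1\<close> and \<open>r = - 1\<close> the
  equation excludes \<open>p $ 1 = C\<close>.\<close>

  

definition hyperbola_branch :: "real \<Rightarrow> real \<Rightarrow> real \<Rightarrow> (real^2) set" where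
  "hyperbola_branch C r s = {p. (p $ 1 - C) * p $ 2 = r * sqrt 2 \<and> s * (p $ 1 - C) \<ge> 0}"

lemma complete_hyperbola_branch:
  assumes r: "r = 1 \<or> r = - 1" and s: "s = 1 \<or> s = - 1"
  shows "complete_solution (\<lambda>t. C + s * exp t) (\<lambda>t. r * s * sqrt 2 * exp (- t)) (hyperbola_branch C r s)"
proof (rule complete_solutionI[where ?X1.0 = "\<lambda>t. s * exp t" and ?X2.0 = "\<lambda>t. s * exp t"
      and ?Z1.0 = "\<lambda>t. - (r * s * sqrt 2 * exp (- t))" and ?Z2.0 = "\<lambda>t. r * s * sqrt 2 * exp (- t)"])
  show "smooth_on_open UNIV (\<lambda>t. C + s * exp t)"
    by (rule smooth_add[OF smooth_const[OF open_UNIV] smooth_mult[OF smooth_const[OF open_UNIV] smooth_exp]])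
  have neg: "smooth_on_open UNIV (\<lambda>t::real. (- 1) * t)"
    by (rule smooth_mult[OF smooth_const[OF open_UNIV] smooth_ident[OF open_UNIV]])
  show "smooth_on_open UNIV (\<lambda>t. r * s * sqrt 2 * exp (- t))"
    using smooth_mult[OF smooth_const[OF open_UNIV, of "r * s * sqrt 2"] smooth_compose[OF smooth_exp neg UNIV_I]]
    by simp
  show "((\<lambda>t. C + s * exp t) has_real_derivative s * exp t) (at t)" for t
    by (rule derivative_eq_intros refl)+ simp
  show "((\<lambda>t. s * exp t) has_real_derivative s * exp t) (at t)" for t
    by (rule derivative_eq_intros refl)+ simp
  show "((\<lambda>t. r * s * sqrt 2 * exp (- t)) has_real_derivative - (r * s * sqrt 2 * exp (- t))) (at t)" for t
    by (rule derivative_eq_intros refl)+ simp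
  show "((\<lambda>t. - (r * s * sqrt 2 * exp (- t))) has_real_derivative r * s * sqrt 2 * exp (- t)) (at t)" for t
    by (rule derivative_eq_intros refl)+ simp
  show "s * exp t \<noteq> 0 \<or> - (r * s * sqrt 2 * exp (- t)) \<noteq> 0" for t
    using s by auto
  show "s * exp t * (r * s * sqrt 2 * exp (- t)) - - (r * s * sqrt 2 * exp (- t)) * (s * exp t)
      = (r * s * sqrt 2 * exp (- t)) ^ 3 * (s * exp t) ^ 3" for t
  proof -
    have e: "exp (- t) * exp t = 1" by (simp flip: exp_add)
    have q: "sqrt 2 ^ 2 = 2" by simp
    have rs: "r ^ 2 = 1" "s ^ 2 = 1" using r s by auto
    show ?thesis using e q rs by algebra
  qed
  show "closed (hyperbola_branch C r s)"
    unfolding hyperbola_branch_def Collect_conj_eq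
    by (intro closed_Int closed_Collect_eq closed_Collect_le continuous_intros)
  show "p \<in> hyperbola_branch C r s \<longleftrightarrow> (\<exists>t. p $ 1 = C + s * exp t \<and> p $ 2 = r * s * sqrt 2 * exp (- t))" for p
  proof
    assume p: "p \<in> hyperbola_branch C r s"
    then have eq: "(p $ 1 - C) * p $ 2 = r * sqrt 2" and ge: "s * (p $ 1 - C) \<ge> 0"
      by (auto simp: hyperbola_branch_def)
    have "p $ 1 - C \<noteq> 0" using eq r by auto
    with ge s have pos: "s * (p $ 1 - C) > 0" by (auto simp: less_le)
    define t where "t = ln (s * (p $ 1 - C))"
    have t: "exp t = s * (p $ 1 - C)" using pos by (simp add: t_def)
    have t1: "p $ 1 = C + s * exp t" unfolding t using s by auto
    have "exp t * p $ 2 = r * s * sqrt 2"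
      unfolding t using eq by (simp add: mult_ac)
    then have "p $ 2 = r * s * sqrt 2 * exp (- t)"
      by (simp add: exp_minus field_simps)
    with t1 show "\<exists>t. p $ 1 = C + s * exp t \<and> p $ 2 = r * s * sqrt 2 * exp (- t)" by blast
  next
    assume "\<exists>t. p $ 1 = C + s * exp t \<and> p $ 2 = r * s * sqrt 2 * exp (- t)"
    then obtain t where t: "p $ 1 = C + s * exp t" "p $ 2 = r * s * sqrt 2 * exp (- t)" by blast
    have e: "exp t * exp (- t) = 1" by (simp flip: exp_add)
    have ss: "s * s = 1" using s by auto
    have "(p $ 1 - C) * p $ 2 = (s * s) * (exp t * exp (- t)) * (r * sqrt 2)"
      unfolding t by (simp add: mult_ac)
    moreover have "s * (p $ 1 - C) = exp t * (s * s)"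
      unfolding t by (simp add: mult_ac)
    ultimately show "p \<in> hyperbola_branch C r s"
      unfolding hyperbola_branch_def e ss by simp
  qed
qed

lemma components_Un_closed:
  assumes "closed A" "closed B" "connected A" "connected B" "A \<noteq> {}" "B \<noteq> {}" "A \<inter> B = {}"
  shows "components (A \<union> B) = {A, B}"
proof -
  have *: "D = A" if "closed A" "closed B" "A \<noteq> {}" "A \<inter> B = {}" "A \<subseteq> D" "D \<subseteq> A \<union> B" "connected D"
    for A B D :: "'a set"
  proof -
    have "A \<inter> D = {} \<or> B \<inter> D = {}"
      by (rule connected_closedD[OF that(7)]) (use that in auto)
    with that show ?thesis by blast
  qed
  have A: "A \<in> components (A \<union> B)"
    unfolding in_components_maximal using assms *[of A B] by blast
  have B: "B \<in> components (A \<union> B)"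
    unfolding in_components_maximal using assms *[of B A] by (metis Un_commute Int_commute Un_upper2)
  have "K = A \<or> K = B" if K: "K \<in> components (A \<union> B)" for K
  proof -
    have "K \<noteq> {}" "K \<subseteq> A \<union> B" 
      using in_components_nonempty[OF K] in_components_subset[OF K] by blast+
    then have "K \<inter> A \<noteq> {} \<or> K \<inter> B \<noteq> {}" by blast
    then show ?thesis
      using components_nonoverlap[OF K A] components_nonoverlap[OF K B] by blast
  qed
  with A B show ?thesis by blast
qed

lemma complete_solution_connected:
  assumes "complete_solution X Z S"
  shows "connected S" "S \<noteq> {}"
proof -
  have sol: "plane_solution UNIV X Z" and S: "range (\<lambda>t. vector [X t, Z t]) = S"
    using assms by (auto simp: complete_solution_def)
  note D = plane_solutionD[OF sol]
  have "(\<lambda>t. vector [X t, Z t] :: real^2) = (\<lambda>t. X t *\<^sub>R axis 1 1 + Z t *\<^sub>R axis 2 1)"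
    by (simp add: fun_eq_iff vec_eq_iff forall_2 axis_def vector_2)
  moreover have "continuous_on UNIV (\<lambda>t. X t *\<^sub>R axis 1 1 + Z t *\<^sub>R axis 2 1 :: real^2)"
    by (intro continuous_intros smooth_continuous[OF D(5)] smooth_continuous[OF D(6)])
  ultimately have "continuous_on UNIV (\<lambda>t. vector [X t, Z t] :: real^2)" by (simp only:)
  from connected_continuous_image[OF this connected_UNIV] show "connected S" unfolding S .
  show "S \<noteq> {}" using S by blast
qed

lemma components_hyperbola:
  assumes r: "r = 1 \<or> r = - 1"
  shows "components {p. (p $ 1 - C) * p $ 2 = r * sqrt 2}
    = {hyperbola_branch C r 1, hyperbola_branch C r (- 1)}"
proof -
  have "{p. (p $ 1 - C) * p $ 2 = r * sqrt 2} = hyperbola_branch C r 1 \<union> hyperbola_branch C r (- 1)"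
    by (auto simp: hyperbola_branch_def)
  moreover have "components (hyperbola_branch C r 1 \<union> hyperbola_branch C r (- 1))
    = {hyperbola_branch C r 1, hyperbola_branch C r (- 1)}"
  proof (rule components_Un_closed)
    have 1: "complete_solution (\<lambda>t. C + 1 * exp t) (\<lambda>t. r * 1 * sqrt 2 * exp (- t)) (hyperbola_branch C r 1)"
      by (rule complete_hyperbola_branch[OF r]) simp
    have 2: "complete_solution (\<lambda>t. C + (- 1) * exp t) (\<lambda>t. r * (- 1) * sqrt 2 * exp (- t)) (hyperbola_branch C r (- 1))"
      by (rule complete_hyperbola_branch[OF r]) simp
    show "closed (hyperbola_branch C r 1)" "closed (hyperbola_branch C r (- 1))"
      using 1 2 by (auto simp: complete_solution_def)
    show "connected (hyperbola_branch C r 1)" "hyperbola_branch C r 1 \<noteq> {}"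
      by (rule complete_solution_connected[OF 1])+
    show "connected (hyperbola_branch C r (- 1))" "hyperbola_branch C r (- 1) \<noteq> {}"
      by (rule complete_solution_connected[OF 2])+
    have False if "(p $ 1 - C) * p $ 2 = r * sqrt 2" "p $ 1 - C \<ge> 0" "p $ 1 - C \<le> 0" for p :: "real^2"
    proof -
      have "p $ 1 - C = 0" using that by linarith
      with that(1) r show False by auto
    qed
    then show "hyperbola_branch C r 1 \<inter> hyperbola_branch C r (- 1) = {}"
      by (force simp: hyperbola_branch_def)
  qed
  ultimately show ?thesis by simp
qed

lemma hyperbola_branches_eq:
  "hyperbola_branches C = {hyperbola_branch C r s | r s. (r = 1 \<or> r = - 1) \<and> (s = 1 \<or> s = - 1)}"
proof -
  have "hyperbola_branches C = {hyperbola_branch C 1 1, hyperbola_branch C 1 (- 1)}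
    \<union> {hyperbola_branch C (- 1) 1, hyperbola_branch C (- 1) (- 1)}"
    unfolding hyperbola_branches_def
    using components_hyperbola[of 1 C] components_hyperbola[of "- 1" C] by simp
  then show ?thesis by auto
qed

section \<open>Antiderivatives as oriented integrals\<close>

text \<open>The integral is oriented, so this is the antiderivative that vanishes at \<open>0\<close> on the
  whole line.\<close>

  

definition primitive :: "(real \<Rightarrow> real) \<Rightarrow> real \<Rightarrow> real" where
  "primitive h s = (LBINT t=ereal 0..ereal s. h t)"

lemma primitive_0 [simp]: "primitive h 0 = 0"
  by (simp add: primitive_def)

lemma primitive_has_derivative:
  assumes h: "continuous_on UNIV h"
  shows "(primitive h has_real_derivative h s) (at s)"
proof -
  define a b where "a = min 0 s - 1" and "b = max 0 s + 1"
  have ab: "a \<le> 0" "0 \<le> b" "a \<le> s" "s \<le> b" and s: "s \<in> interior {a..b}"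
    by (auto simp: a_def b_def)
  have "((\<lambda>u. LBINT y=ereal 0..ereal u. h y) has_vector_derivative h s) (at s within {a..b})"
    by (rule interval_integral_FTC2[OF ab(1,2) continuous_on_subset[OF h subset_UNIV] ab(3,4)])
  then show ?thesis
    unfolding at_within_interior[OF s] primitive_def[abs_def]
    by (simp add: has_real_derivative_iff_has_vector_derivative)
qed

section \<open>The curves of positive energy\<close>

text \<open>The absolute value of the slope at height \<open>t\<close> of a graph with energy \<open>C\<close>.\<close>

  

definition slope_pos :: "real \<Rightarrow> real \<Rightarrow> real" where
  "slope_pos C t = sqrt (1/2 * t ^ 4 + C)"

lemma slope_pos_pos: "C > 0 \<Longrightarrow> slope_pos C t > 0"
  unfolding slope_pos_def by (simp add: add_nonneg_pos)

lemma smooth_slope_pos: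
  assumes C: "C > 0"
  shows "smooth_on_open UNIV (slope_pos C)"
  unfolding slope_pos_def[abs_def]
proof (rule smooth_sqrt)
  show "smooth_on_open UNIV (\<lambda>t. 1/2 * t ^ 4 + C)"
    by (rule smooth_add[OF smooth_mult[OF smooth_const[OF open_UNIV] smooth_power[OF smooth_ident[OF open_UNIV]]]
          smooth_const[OF open_UNIV]])
  show "0 < 1/2 * t ^ 4 + C" for t
    using C by (simp add: add_nonneg_pos)
qed

lemma slope_pos_has_derivative:
  assumes C: "C > 0"
  shows "(slope_pos C has_real_derivative t ^ 3 / slope_pos C t) (at t)"
proof -
  have pos: "1/2 * t ^ 4 + C > 0" using C by (simp add: add_nonneg_pos)
  have "((\<lambda>t. 1/2 * t ^ 4 + C) has_real_derivative 2 * t ^ 3) (at t)"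
    by (rule derivative_eq_intros refl)+ simp
  from DERIV_chain2[OF DERIV_real_sqrt[OF pos] this] show ?thesis
    unfolding slope_pos_def[abs_def] by (simp add: field_simps)
qed

text \<open>The horizontal distance covered while the height goes from \<open>0\<close> to its argument.\<close>

  

abbreviation travel_pos :: "real \<Rightarrow> real \<Rightarrow> real" where
  "travel_pos C \<equiv> primitive (\<lambda>t. inverse (slope_pos C t))"

lemma smooth_inverse_slope_pos:
  "C > 0 \<Longrightarrow> smooth_on_open UNIV (\<lambda>t. inverse (slope_pos C t))"
  by (rule smooth_inverse[OF smooth_slope_pos]) (simp_all add: slope_pos_pos less_imp_neq[OF slope_pos_pos, symmetric])

lemma travel_pos_has_derivative:
  "C > 0 \<Longrightarrow> (travel_pos C has_real_derivative inverse (slope_pos C t)) (at t)"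
  by (rule primitive_has_derivative[OF smooth_continuous[OF smooth_inverse_slope_pos]])

definition monotone_curve :: "real \<Rightarrow> real \<Rightarrow> real \<Rightarrow> (real^2) set" where
  "monotone_curve C1 C2 s = {p. p $ 1 = s * travel_pos C1 (p $ 2) + C2}"

lemma increasing_curve_eq: "increasing_curve C1 C2 = monotone_curve C1 C2 1"
  and decreasing_curve_eq: "decreasing_curve C1 C2 = monotone_curve C1 C2 (- 1)"
  by (auto simp: increasing_curve_def decreasing_curve_def monotone_curve_def primitive_def
      slope_pos_def inverse_eq_divide zero_ereal_def)

lemma complete_monotone_curve:
  assumes C: "C1 > 0" and s: "s = 1 \<or> s = - 1"
  shows "complete_solution (\<lambda>t. s * travel_pos C1 t + C2) (\<lambda>t. t) (monotone_curve C1 C2 s)"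
proof (rule complete_solutionI[where ?X1.0 = "\<lambda>t. s * inverse (slope_pos C1 t)"
      and ?X2.0 = "\<lambda>t. s * - (t ^ 3 / slope_pos C1 t ^ 3)" and ?Z1.0 = "\<lambda>_. 1" and ?Z2.0 = "\<lambda>_. 0"])
  have sm: "smooth_on_open UNIV (travel_pos C1)"
    by (rule smooth_of_derivative[OF smooth_inverse_slope_pos[OF C] travel_pos_has_derivative[OF C]])
  show "smooth_on_open UNIV (\<lambda>t. s * travel_pos C1 t + C2)"
    by (rule smooth_add[OF smooth_mult[OF smooth_const[OF open_UNIV] sm] smooth_const[OF open_UNIV]])
  show "smooth_on_open UNIV (\<lambda>t::real. t)" by (rule smooth_ident[OF open_UNIV])
  have nz: "slope_pos C1 t \<noteq> 0" for t using slope_pos_pos[OF C, of t] by simp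
  show "((\<lambda>t. s * travel_pos C1 t + C2) has_real_derivative s * inverse (slope_pos C1 t)) (at t)" for t
    by (rule derivative_eq_intros refl travel_pos_has_derivative[OF C])+ simp
  have "((\<lambda>t. inverse (slope_pos C1 t)) has_real_derivative - (t ^ 3 / slope_pos C1 t ^ 3)) (at t)" for t
    by (rule derivative_eq_intros refl slope_pos_has_derivative[OF C] nz)+
      (simp add: field_simps power3_eq_cube)
  from DERIV_cmult[OF this]
  show "((\<lambda>t. s * inverse (slope_pos C1 t)) has_real_derivative s * - (t ^ 3 / slope_pos C1 t ^ 3)) (at t)" for t .
  show "((\<lambda>t. t) has_real_derivative 1) (at t)" for t :: real by (rule DERIV_ident)
  show "((\<lambda>_. 1) has_real_derivative 0) (at t)" for t :: real by (rule DERIV_const)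
  show "s * inverse (slope_pos C1 t) \<noteq> 0 \<or> (1::real) \<noteq> 0" for t by simp
  show "s * inverse (slope_pos C1 t) * 0 - 1 * (s * - (t ^ 3 / slope_pos C1 t ^ 3))
      = t ^ 3 * (s * inverse (slope_pos C1 t)) ^ 3" for t
    using s nz[of t] by (auto simp: field_simps)
  have "continuous_on UNIV (\<lambda>p::real^2. travel_pos C1 (p $ 2))"
    by (rule continuous_on_compose2[OF smooth_continuous[OF sm]]) (auto intro!: continuous_intros)
  then show "closed (monotone_curve C1 C2 s)"
    unfolding monotone_curve_def by (intro closed_Collect_eq continuous_intros)
  show "p \<in> monotone_curve C1 C2 s \<longleftrightarrow> (\<exists>t. p $ 1 = s * travel_pos C1 t + C2 \<and> p $ 2 = t)" for p
    by (auto simp: monotone_curve_def)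
qed

section \<open>The curves of negative energy\<close>

text \<open>With \<open>y = a + s\<^sup>2\<close> the quartic \<open>(y\<^sup>4 - a\<^sup>4)/2\<close> is \<open>s\<^sup>2\<close> times \<open>quotient_poly a (s\<^sup>2) /
  2\<close>; the second factor is positive, so its root is a smooth function of \<open>s\<close>, also at the
  vertex.\<close>

  

definition quotient_poly :: "real \<Rightarrow> real \<Rightarrow> real" where
  "quotient_poly a w = 4 * a ^ 3 + 6 * a ^ 2 * w + 4 * a * w ^ 2 + w ^ 3"

text \<open>The slope of a graph with energy \<open>- a ^ 4 / 2\<close> at height \<open>a + s ^ 2\<close> is \<open>s * slope_neg
  a s\<close>.\<close>

  

definition slope_neg :: "real \<Rightarrow> real \<Rightarrow> real" where
  "slope_neg a s = sqrt (quotient_poly a (s ^ 2) / 2)"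

definition slope_neg' :: "real \<Rightarrow> real \<Rightarrow> real" where
  "slope_neg' a s = s * (6 * a ^ 2 + 8 * a * s ^ 2 + 3 * s ^ 4) / (2 * slope_neg a s)"

lemma quotient_poly_pos:
  assumes "a > 0" "w \<ge> 0"
  shows "quotient_poly a w > 0"
proof -
  have "4 * a ^ 3 > 0" "6 * a ^ 2 * w \<ge> 0" "4 * a * w ^ 2 \<ge> 0" "w ^ 3 \<ge> 0"
    using assms by simp_all
  then show ?thesis unfolding quotient_poly_def by linarith
qed

lemma slope_neg_pos: "a > 0 \<Longrightarrow> slope_neg a s > 0"
  unfolding slope_neg_def using quotient_poly_pos[of a "s ^ 2"] by simp

lemma slope_neg_sq: "a > 0 \<Longrightarrow> slope_neg a s ^ 2 = quotient_poly a (s ^ 2) / 2"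
  unfolding slope_neg_def using quotient_poly_pos[of a "s ^ 2"] by simp

lemma slope_neg_even: "slope_neg a (- s) = slope_neg a s"
  by (simp add: slope_neg_def)

lemma slope_neg_energy:
  assumes "a > 0"
  shows "(s * slope_neg a s) ^ 2 = ((a + s ^ 2) ^ 4 - a ^ 4) / 2"
  unfolding power_mult_distrib slope_neg_sq[OF assms] quotient_poly_def by algebra

lemma quotient_poly_half:
  "quotient_poly a (s ^ 2) / 2 = 2 * a ^ 3 + 3 * a ^ 2 * s ^ 2 + 2 * a * s ^ 4 + (1/2) * s ^ 6"
proof -
  have "s ^ 4 = (s ^ 2) ^ 2" "s ^ 6 = (s ^ 2) ^ 3" by (simp_all flip: power_mult)
  then show ?thesis unfolding quotient_poly_def by simp
qed

lemma smooth_slope_neg: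
  assumes a: "a > 0"
  shows "smooth_on_open UNIV (slope_neg a)"
proof -
  note c = smooth_const[OF open_UNIV] and sq = smooth_power[OF smooth_ident[OF open_UNIV]]
  have "smooth_on_open UNIV (\<lambda>s. quotient_poly a (s ^ 2) / 2)"
    unfolding quotient_poly_half
    by (rule smooth_add[OF smooth_add[OF smooth_add[OF c smooth_mult[OF c sq]] smooth_mult[OF c sq]]
          smooth_mult[OF c sq]])
  from smooth_sqrt[OF this] show ?thesis
    unfolding slope_neg_def[abs_def] using quotient_poly_pos[OF a] by simp
qed

lemma slope_neg_has_derivative:
  assumes a: "a > 0"
  shows "(slope_neg a has_real_derivative slope_neg' a s) (at s)"
proof -
  have pos: "quotient_poly a (s ^ 2) / 2 > 0" using quotient_poly_pos[OF a, of "s ^ 2"] by simp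
  have "((\<lambda>s. quotient_poly a (s ^ 2) / 2) has_real_derivative
      s * (6 * a ^ 2 + 8 * a * s ^ 2 + 3 * s ^ 4)) (at s)"
    unfolding quotient_poly_half
    by (rule derivative_eq_intros refl)+ (simp add: algebra_simps eval_nat_numeral)
  from DERIV_chain2[OF DERIV_real_sqrt[OF pos] this] show ?thesis
    unfolding slope_neg'_def slope_neg_def[abs_def] by (simp add: field_simps)
qed

text \<open>With \<open>w = s\<^sup>2\<close> this is half the derivative with respect to \<open>w\<close> of \<open>w * quotient_poly a
  w = (a + w)\<^sup>4 - a\<^sup>4\<close>. It is the equation \<open>f'' = f\<^sup>3\<close> of the graph, expressed in the
  parameter \<open>s\<close>.\<close>

  

lemma slope_neg_ode:
  assumes a: "a > 0"
  shows "slope_neg a s ^ 2 + s * slope_neg a s * slope_neg' a s = 2 * (a + s ^ 2) ^ 3"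
proof -
  define K where "K = 6 * a ^ 2 + 8 * a * s ^ 2 + 3 * s ^ 4"
  have "slope_neg a s \<noteq> 0" using slope_neg_pos[OF a, of s] by simp
  then have 1: "slope_neg a s * slope_neg' a s = s * K / 2"
    unfolding slope_neg'_def K_def[symmetric] by (simp add: field_simps)
  have "s ^ 4 = (s ^ 2) ^ 2" by (simp flip: power_mult)
  then have K: "K = 6 * a ^ 2 + 8 * a * s ^ 2 + 3 * (s ^ 2) ^ 2" unfolding K_def by simp
  have poly: "quotient_poly a w + w * (6 * a ^ 2 + 8 * a * w + 3 * w ^ 2) = 4 * (a + w) ^ 3" for w
    unfolding quotient_poly_def by algebra
  have "slope_neg a s ^ 2 + s * slope_neg a s * slope_neg' a s = (quotient_poly a (s ^ 2) + s ^ 2 * K) / 2"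
    using slope_neg_sq[OF a, of s] 1 by (simp add: mult.assoc power2_eq_square)
  also have "\<dots> = 2 * (a + s ^ 2) ^ 3"
    unfolding K poly by simp
  finally show ?thesis .
qed

text \<open>From \<open>dy = 2 s ds\<close> and \<open>dy/dx = s * slope_neg a s\<close> one gets \<open>dx = 2 ds / slope_neg a
  s\<close>, which is regular at the vertex \<open>s = 0\<close>.\<close>

  

abbreviation travel_neg :: "real \<Rightarrow> real \<Rightarrow> real" where
  "travel_neg a \<equiv> primitive (\<lambda>s. 2 * inverse (slope_neg a s))"

lemma smooth_inverse_slope_neg:
  assumes a: "a > 0"
  shows "smooth_on_open UNIV (\<lambda>s. 2 * inverse (slope_neg a s))"
proof (rule smooth_mult[OF smooth_const[OF open_UNIV] smooth_inverse[OF smooth_slope_neg[OF a]]])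
  show "slope_neg a s \<noteq> 0" for s using slope_neg_pos[OF a, of s] by simp
qed

lemma travel_neg_has_derivative:
  "a > 0 \<Longrightarrow> (travel_neg a has_real_derivative 2 * inverse (slope_neg a s)) (at s)"
  by (rule primitive_has_derivative[OF smooth_continuous[OF smooth_inverse_slope_neg]])

lemma travel_neg_odd:
  assumes a: "a > 0"
  shows "travel_neg a (- s) = - travel_neg a s"
proof -
  have "((\<lambda>s. travel_neg a s + travel_neg a (- s)) has_real_derivative 0) (at s)" for s
  proof -
    have "((\<lambda>s. travel_neg a (- s)) has_real_derivative 2 * inverse (slope_neg a (- s)) * (- 1)) (at s)"
      by (rule DERIV_chain2[OF travel_neg_has_derivative[OF a]]) (rule derivative_eq_intros refl)+
    from DERIV_add[OF travel_neg_has_derivative[OF a] this] show ?thesis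
      by (simp add: slope_neg_even)
  qed
  then have "travel_neg a s + travel_neg a (- s) = travel_neg a 0 + travel_neg a (- 0)"
    by (intro DERIV_isconst_all) blast
  then show ?thesis by simp
qed

text \<open>The substitution \<open>\<xi> = a + s\<^sup>2\<close> removes the singularity of the integrand at \<open>a\<close>. As the
  integrand is nonnegative and its antiderivative is continuous up to \<open>a\<close>, the improper
  integral exists.\<close>

  

lemma travel_neg_integral:
  assumes a: "a > 0" and y: "y \<ge> a"
  shows "(LBINT \<xi>=ereal a..ereal y. 1 / sqrt (1/2 * \<xi> ^ 4 - a ^ 4 / 2)) = travel_neg a (sqrt (y - a))"
proof (cases "y = a")
  case True
  then show ?thesis by simp
next
  case False
  with y have ay: "a < y" by simp
  define F where "F = (\<lambda>\<xi>. travel_neg a (sqrt (\<xi> - a)))"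
  have contH: "isCont (travel_neg a) s" for s
    by (rule DERIV_isCont[OF travel_neg_has_derivative[OF a]])
  have contF: "isCont F \<xi>" for \<xi>
    unfolding F_def by (rule isCont_o2[OF _ contH]) (intro continuous_intros)
  have pos: "1/2 * \<xi> ^ 4 - a ^ 4 / 2 > 0" if "a < \<xi>" for \<xi>
    using power_strict_mono[OF that, of 4] a by simp
  have "(LBINT \<xi>=ereal a..ereal y. 1 / sqrt (1/2 * \<xi> ^ 4 - a ^ 4 / 2)) = F y - F a"
  proof (rule interval_integral_FTC_nonneg(2))
    show "ereal a < ereal y" using ay by simp
    show "DERIV F \<xi> :> 1 / sqrt (1/2 * \<xi> ^ 4 - a ^ 4 / 2)" if "ereal a < ereal \<xi>" for \<xi>
    proof -
      define s where "s = sqrt (\<xi> - a)"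
      have \<xi>: "\<xi> - a > 0" using that by simp
      have s: "s > 0" "\<xi> = a + s ^ 2" using \<xi> by (auto simp: s_def)
      have ds: "((\<lambda>\<xi>. sqrt (\<xi> - a)) has_real_derivative inverse s / 2 * 1) (at \<xi>)"
        unfolding s_def
        by (rule DERIV_chain2[where f = sqrt and g = "\<lambda>\<xi>. \<xi> - a", OF DERIV_real_sqrt[OF \<xi>]])
          (rule derivative_eq_intros refl | simp)+
      have "s * slope_neg a s > 0" using s slope_neg_pos[OF a, of s] by simp
      then have "sqrt (1/2 * \<xi> ^ 4 - a ^ 4 / 2) = s * slope_neg a s"
        using slope_neg_energy[OF a, of s] unfolding s(2)
        by (intro real_sqrt_unique) (simp_all add: field_simps)
      then have "1 / sqrt (1/2 * \<xi> ^ 4 - a ^ 4 / 2) = 2 * inverse (slope_neg a s) * (inverse s / 2 * 1)"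
        by (simp add: field_simps)
      then show ?thesis
        using DERIV_chain2[OF travel_neg_has_derivative[OF a] ds]
        unfolding F_def s_def[symmetric] by simp
    qed
    show "isCont (\<lambda>\<xi>. 1 / sqrt (1/2 * \<xi> ^ 4 - a ^ 4 / 2)) \<xi>" if "ereal a < ereal \<xi>" for \<xi>
    proof -
      have "sqrt (1/2 * \<xi> ^ 4 - a ^ 4 / 2) \<noteq> 0" using pos[of \<xi>] that by simp
      then show ?thesis by (intro continuous_intros)
    qed
    have "0 \<le> 1 / sqrt (1/2 * \<xi> ^ 4 - a ^ 4 / 2)" if "ereal a < ereal \<xi>" for \<xi>
      using pos[of \<xi>] that by simp
    then show "AE \<xi> in lborel. ereal a < ereal \<xi> \<longrightarrow> ereal \<xi> < ereal y \<longrightarrow>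
        0 \<le> 1 / sqrt (1/2 * \<xi> ^ 4 - a ^ 4 / 2)"
      by (intro always_eventually) blast
    have "(F \<longlongrightarrow> F a) (at_right a)" "(F \<longlongrightarrow> F y) (at_left y)"
      using contF[of a] contF[of y] unfolding isCont_def
      by (auto intro: filterlim_mono at_le)
    then show "((F \<circ> real_of_ereal) \<longlongrightarrow> F a) (at_right (ereal a))"
      "((F \<circ> real_of_ereal) \<longlongrightarrow> F y) (at_left (ereal y))"
      by (simp_all add: ereal_tendsto_simps)
  qed
  then show ?thesis by (simp add: F_def)
qed

text \<open>The sign \<open>s\<close> is \<open>1\<close> for the convex and \<open>- 1\<close> for the concave curves; reflection in the
  x-axis exchanges them.\<close>

  

definition vertex_curve :: "real \<Rightarrow> real \<Rightarrow> real \<Rightarrow> (real^2) set" where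
  "vertex_curve a C2 s = {p. a \<le> s * p $ 2 \<and> (p $ 1 - C2)\<^sup>2 = (travel_neg a (sqrt (s * p $ 2 - a)))\<^sup>2}"

lemma root4:
  assumes "C1 > 0"
  shows "root 4 (2 * C1) > 0" "C1 = root 4 (2 * C1) ^ 4 / 2"
  using assms by simp_all

lemma convex_curve_eq:
  assumes C: "C1 > 0"
  shows "convex_curve C1 C2 = vertex_curve (root 4 (2 * C1)) C2 1"
proof -
  define a where "a = root 4 (2 * C1)"
  have a: "a > 0" "C1 = a ^ 4 / 2" using root4[OF C] by (simp_all add: a_def)
  show ?thesis
    unfolding convex_curve_def vertex_curve_def a_def[symmetric]
    unfolding a(2)
    using travel_neg_integral[OF a(1)] by auto
qed

lemma concave_curve_eq:
  assumes C: "C1 > 0"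
  shows "concave_curve C1 C2 = vertex_curve (root 4 (2 * C1)) C2 (- 1)"
proof -
  define a where "a = root 4 (2 * C1)"
  have a: "a > 0" "C1 = a ^ 4 / 2" using root4[OF C] by (simp_all add: a_def)
  have "(LBINT \<xi>=ereal y..ereal (- a). 1 / sqrt (1/2 * \<xi> ^ 4 - a ^ 4 / 2)) = travel_neg a (sqrt (- y - a))"
    if "y \<le> - a" for y
    using travel_neg_integral[OF a(1), of "- y"] that
    by (subst interval_integral_reflect) simp
  then show ?thesis
    unfolding concave_curve_def vertex_curve_def a_def[symmetric]
    unfolding a(2) by auto
qed

text \<open>The square in the definition of the curve merges the two halves, reached from the
  vertex with positive and with negative parameter; oddness of \<open>travel_neg a\<close> separates them
  again.\<close>

  

lemma complete_vertex_curve: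
  assumes a: "a > 0" and s: "s = 1 \<or> s = - 1"
  shows "complete_solution (\<lambda>t. C2 + travel_neg a t) (\<lambda>t. s * (a + t ^ 2)) (vertex_curve a C2 s)"
proof (rule complete_solutionI[where ?X1.0 = "\<lambda>t. 2 * inverse (slope_neg a t)"
      and ?X2.0 = "\<lambda>t. 2 * - (slope_neg' a t / slope_neg a t ^ 2)"
      and ?Z1.0 = "\<lambda>t. s * (2 * t)" and ?Z2.0 = "\<lambda>t. s * 2"])
  note c = smooth_const[OF open_UNIV]
  have sm: "smooth_on_open UNIV (travel_neg a)"
    by (rule smooth_of_derivative[OF smooth_inverse_slope_neg[OF a] travel_neg_has_derivative[OF a]])
  show "smooth_on_open UNIV (\<lambda>t. C2 + travel_neg a t)"
    by (rule smooth_add[OF c sm])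
  show "smooth_on_open UNIV (\<lambda>t. s * (a + t ^ 2))"
    by (rule smooth_mult[OF c smooth_add[OF c smooth_power[OF smooth_ident[OF open_UNIV]]]])
  have nz: "slope_neg a t \<noteq> 0" for t using slope_neg_pos[OF a, of t] by simp
  show "((\<lambda>t. C2 + travel_neg a t) has_real_derivative 2 * inverse (slope_neg a t)) (at t)" for t
    by (rule derivative_eq_intros refl travel_neg_has_derivative[OF a])+ simp
  have "((\<lambda>t. inverse (slope_neg a t)) has_real_derivative - (slope_neg' a t / slope_neg a t ^ 2)) (at t)" for t
    by (rule derivative_eq_intros refl slope_neg_has_derivative[OF a] nz)+
      (simp add: field_simps power2_eq_square)
  from DERIV_cmult[OF this]
  show "((\<lambda>t. 2 * inverse (slope_neg a t)) has_real_derivative 2 * - (slope_neg' a t / slope_neg a t ^ 2)) (at t)" for t .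
  show "((\<lambda>t. s * (a + t ^ 2)) has_real_derivative s * (2 * t)) (at t)" for t
    by (rule derivative_eq_intros refl)+ simp
  show "((\<lambda>t. s * (2 * t)) has_real_derivative s * 2) (at t)" for t
    by (rule derivative_eq_intros refl)+ simp
  show "2 * inverse (slope_neg a t) \<noteq> 0 \<or> s * (2 * t) \<noteq> 0" for t using nz by simp
  show "2 * inverse (slope_neg a t) * (s * 2) - s * (2 * t) * (2 * - (slope_neg' a t / slope_neg a t ^ 2))
      = (s * (a + t ^ 2)) ^ 3 * (2 * inverse (slope_neg a t)) ^ 3" for t
  proof -
    define i where "i = inverse (slope_neg a t)"
    have i: "slope_neg a t * i = 1" using nz[of t] by (simp add: i_def)
    have s3: "s ^ 3 = s" using s by auto
    have q: "slope_neg' a t / slope_neg a t ^ 2 = slope_neg' a t * i ^ 2"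
      by (simp add: i_def divide_inverse power_inverse)
    show ?thesis
      unfolding q i_def[symmetric] using slope_neg_ode[OF a, of t] i s3 by algebra
  qed
  have cont: "continuous_on UNIV (\<lambda>p::real^2. travel_neg a (sqrt (s * p $ 2 - a)))"
    by (rule continuous_on_compose2[OF smooth_continuous[OF sm]]) (auto intro!: continuous_intros)
  show "closed (vertex_curve a C2 s)"
    unfolding vertex_curve_def Collect_conj_eq
    by (intro closed_Int closed_Collect_eq closed_Collect_le continuous_intros cont)
  have ss: "s * s = 1" using s by auto
  show "p \<in> vertex_curve a C2 s \<longleftrightarrow> (\<exists>t. p $ 1 = C2 + travel_neg a t \<and> p $ 2 = s * (a + t ^ 2))" for p
  proof
    assume p: "p \<in> vertex_curve a C2 s"
    define r where "r = sqrt (s * p $ 2 - a)"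
    have r: "r ^ 2 = s * p $ 2 - a" and sq: "(p $ 1 - C2) ^ 2 = (travel_neg a r) ^ 2"
      using p by (simp_all add: vertex_curve_def r_def)
    have "s * (a + r ^ 2) = (s * s) * p $ 2" unfolding r by (simp add: algebra_simps)
    then have y: "p $ 2 = s * (a + r ^ 2)" unfolding ss by simp
    from sq have "p $ 1 - C2 = travel_neg a r \<or> p $ 1 - C2 = travel_neg a (- r)"
      unfolding travel_neg_odd[OF a] by (simp add: power2_eq_iff)
    then show "\<exists>t. p $ 1 = C2 + travel_neg a t \<and> p $ 2 = s * (a + t ^ 2)"
    proof
      assume "p $ 1 - C2 = travel_neg a r"
      with y show ?thesis by (intro exI[of _ r]) simp
    next
      assume "p $ 1 - C2 = travel_neg a (- r)"
      with y show ?thesis by (intro exI[of _ "- r"]) simp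
    qed
  next
    assume "\<exists>t. p $ 1 = C2 + travel_neg a t \<and> p $ 2 = s * (a + t ^ 2)"
    then obtain t where t: "p $ 1 = C2 + travel_neg a t" "p $ 2 = s * (a + t ^ 2)" by blast
    have "s * p $ 2 = (s * s) * (a + t ^ 2)" unfolding t by simp
    then have sp: "s * p $ 2 = a + t ^ 2" unfolding ss by simp
    have "(travel_neg a \<bar>t\<bar>) ^ 2 = (travel_neg a t) ^ 2"
      using travel_neg_odd[OF a, of t] by (simp add: abs_if)
    then show "p \<in> vertex_curve a C2 s"
      unfolding vertex_curve_def by (simp add: sp t(1))
  qed
qed

section \<open>The list of curves\<close>

lemma vertical_line_classified: "vertical_line C \<in> classified_curves"
  and x_axis_classified: "x_axis \<in> classified_curves"
  unfolding classified_curves_def by blast+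

lemma hyperbola_branch_classified:
  assumes "r = 1 \<or> r = - 1" "s = 1 \<or> s = - 1"
  shows "hyperbola_branch C r s \<in> classified_curves"
proof -
  have "hyperbola_branch C r s \<in> hyperbola_branches C"
    unfolding hyperbola_branches_eq using assms by blast
  then show ?thesis unfolding classified_curves_def by blast
qed

lemma monotone_curve_classified:
  assumes "C1 > 0" and s: "s = 1 \<or> s = - 1"
  shows "monotone_curve C1 C2 s \<in> classified_curves"
proof -
  have "increasing_curve C1 C2 \<in> classified_curves" "decreasing_curve C1 C2 \<in> classified_curves"
    unfolding classified_curves_def using assms(1) by blast+
  with s show ?thesis unfolding increasing_curve_eq decreasing_curve_eq by auto
qed

lemma vertex_curve_classified:
  assumes a: "a > 0" and s: "s = 1 \<or> s = - 1"
  shows "vertex_curve a C2 s \<in> classified_curves"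
proof -
  have C: "a ^ 4 / 2 > 0" and r: "root 4 (2 * (a ^ 4 / 2)) = a"
    using a by (simp_all add: real_root_power_cancel)
  have "convex_curve (a ^ 4 / 2) C2 \<in> classified_curves" "concave_curve (a ^ 4 / 2) C2 \<in> classified_curves"
    unfolding classified_curves_def using C by blast+
  with s show ?thesis unfolding convex_curve_eq[OF C] concave_curve_eq[OF C] r by auto
qed

lemma classified_complete:
  assumes "S \<in> classified_curves"
  shows "\<exists>X Z. complete_solution X Z S"
proof -
  consider C where "S = vertical_line C" | "S = x_axis" | C where "S \<in> hyperbola_branches C"
    | C1 C2 where "C1 > 0" "S = convex_curve C1 C2" | C1 C2 where "C1 > 0" "S = concave_curve C1 C2"
    | C1 C2 where "C1 > 0" "S = increasing_curve C1 C2" | C1 C2 where "C1 > 0" "S = decreasing_curve C1 C2"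
    using assms unfolding classified_curves_def by blast
  then show ?thesis
  proof cases
    case 1
    then show ?thesis using complete_vertical_line by blast
  next
    case 2
    then show ?thesis using complete_x_axis by blast
  next
    case 3
    then obtain r s where "S = hyperbola_branch C r s" "r = 1 \<or> r = - 1" "s = 1 \<or> s = - 1"
      unfolding hyperbola_branches_eq by blast
    then show ?thesis using complete_hyperbola_branch by blast
  next
    case 4
    then show ?thesis
      using complete_vertex_curve[OF root4(1)[OF 4(1)], of 1] unfolding convex_curve_eq[OF 4(1)] by blast
  next
    case 5
    then show ?thesis
      using complete_vertex_curve[OF root4(1)[OF 5(1)], of "- 1"] unfolding concave_curve_eq[OF 5(1)] by blast
  next
    case 6
    then show ?thesis
      using complete_monotone_curve[OF 6(1), of 1] unfolding increasing_curve_eq by blast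
  next
    case 7
    then show ?thesis
      using complete_monotone_curve[OF 7(1), of "- 1"] unfolding decreasing_curve_eq by blast
  qed
qed

section \<open>Integrating the equation\<close>

lemma constant_on_interval:
  fixes f :: "real \<Rightarrow> real"
  assumes I: "is_interval I" and der: "\<And>u. u \<in> I \<Longrightarrow> (f has_real_derivative 0) (at u)"
  shows "\<exists>K. \<forall>u\<in>I. f u = K"
proof -
  have "convex I" using I by (simp add: is_interval_convex)
  from has_field_derivative_zero_constant[OF this has_field_derivative_at_within[OF der]]
  show ?thesis by blast
qed

lemma constant_sign:
  fixes f :: "real \<Rightarrow> real"
  assumes I: "is_interval I" and cont: "continuous_on I f" and nz: "\<And>u. u \<in> I \<Longrightarrow> f u \<noteq> 0"
  shows "\<exists>s. (s = 1 \<or> s = - 1) \<and> (\<forall>u\<in>I. s * f u > 0)"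
proof -
  have con: "connected (f ` I)"
    by (rule connected_continuous_image[OF cont is_interval_connected[OF I]])
  have "\<not> (f u < 0 \<and> 0 < f v)" if "u \<in> I" "v \<in> I" for u v
  proof
    assume "f u < 0 \<and> 0 < f v"
    then have "0 \<in> f ` I"
      using connectedD_interval[OF con imageI[OF that(1)] imageI[OF that(2)], of 0] by simp
    with nz show False by force
  qed
  then have "(\<forall>u\<in>I. 1 * f u > 0) \<or> (\<forall>u\<in>I. - 1 * f u > 0)"
    using nz by (force simp: not_less linorder_neq_iff)
  then show ?thesis by blast
qed

definition graph_slope :: "(real \<Rightarrow> real) \<Rightarrow> (real \<Rightarrow> real) \<Rightarrow> real \<Rightarrow> real" where
  "graph_slope x y u = d1 y u / d1 x u"

text \<open>Let the solution be a graph over the x-axis, with slope \<open>q = y'/x'\<close>. The equation then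
  says \<open>q' = y\<^sup>3 x'\<close>, and with \<open>y' = q x'\<close> the energy \<open>q\<^sup>2 - y\<^sup>4/2\<close> is constant along the
  curve.\<close>

  

context
  fixes I x y
  assumes sol: "plane_solution I x y" and graph: "\<And>u. u \<in> I \<Longrightarrow> d1 x u \<noteq> 0"
begin

lemmas graph_facts = plane_solutionD[OF sol]

lemma y_derivative: "u \<in> I \<Longrightarrow> (y has_real_derivative graph_slope x y u * d1 x u) (at u)"
  using has_derivative_d1[OF graph_facts(6)] graph by (simp add: graph_slope_def)

lemma slope_derivative:
  assumes u: "u \<in> I"
  shows "(graph_slope x y has_real_derivative y u ^ 3 * d1 x u) (at u)"
proof -
  have "((\<lambda>u. d1 y u / d1 x u) has_real_derivative
      (d2 y u * d1 x u - d1 y u * d2 x u) / (d1 x u * d1 x u)) (at u)"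
    by (rule DERIV_divide[OF has_derivative_d2[OF graph_facts(6) u] has_derivative_d2[OF graph_facts(5) u] graph[OF u]])
  moreover have "d2 y u * d1 x u - d1 y u * d2 x u = y u ^ 3 * d1 x u ^ 3"
    using graph_facts(8)[OF u] by (simp add: mult.commute)
  moreover have "y u ^ 3 * d1 x u ^ 3 / (d1 x u * d1 x u) = y u ^ 3 * d1 x u"
    using graph[OF u] by (simp add: power3_eq_cube)
  ultimately show ?thesis
    unfolding graph_slope_def[abs_def] by simp
qed

lemma energy_constant: "\<exists>c. \<forall>u\<in>I. graph_slope x y u ^ 2 = 1/2 * y u ^ 4 + c"
proof -
  have "((\<lambda>u. graph_slope x y u ^ 2 - 1/2 * y u ^ 4) has_real_derivative 0) (at u)" if u: "u \<in> I" for u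
    by (rule derivative_eq_intros refl slope_derivative[OF u] y_derivative[OF u])+ (simp add: algebra_simps)
  from constant_on_interval[OF graph_facts(2) this] obtain c
    where c: "\<And>u. u \<in> I \<Longrightarrow> graph_slope x y u ^ 2 - 1/2 * y u ^ 4 = c" by blast
  have "graph_slope x y u ^ 2 = 1/2 * y u ^ 4 + c" if "u \<in> I" for u
    using c[OF that] by linarith
  then show ?thesis by blast
qed

lemma continuous_y: "continuous_on I y"
  by (rule smooth_continuous[OF graph_facts(6)])

lemma continuous_slope: "continuous_on I (graph_slope x y)"
  by (intro continuous_at_imp_continuous_on ballI DERIV_isCont[OF slope_derivative])

text \<open>The slope has no zeros, hence a constant sign \<open>s\<close>, and \<open>q\<close> is a function of the
  height. Separating the variables, \<open>x - s * travel_pos c y\<close> is constant.\<close>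

  

lemma positive_energy:
  assumes c: "c > 0" and E: "\<And>u. u \<in> I \<Longrightarrow> graph_slope x y u ^ 2 = 1/2 * y u ^ 4 + c"
  shows "\<exists>S\<in>classified_curves. \<forall>u\<in>I. vector [x u, y u] \<in> S"
proof -
  have "graph_slope x y u \<noteq> 0" if "u \<in> I" for u
  proof
    assume "graph_slope x y u = 0"
    then have "1/2 * y u ^ 4 + c = 0" using E[OF that] by simp
    moreover have "1/2 * y u ^ 4 \<ge> 0" by simp
    ultimately show False using c by linarith
  qed
  then obtain s where s: "s = 1 \<or> s = - 1" "\<And>u. u \<in> I \<Longrightarrow> s * graph_slope x y u > 0"
    using constant_sign[OF graph_facts(2) continuous_slope] by blast
  have ss: "s ^ 2 = 1" using s(1) by auto
  have slope: "slope_pos c (y u) = s * graph_slope x y u" if "u \<in> I" for u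
    unfolding slope_pos_def
    by (rule real_sqrt_unique) (use s(2)[OF that] E[OF that] ss in \<open>simp_all add: power_mult_distrib\<close>)
  have "((\<lambda>u. x u - s * travel_pos c (y u)) has_real_derivative 0) (at u)" if u: "u \<in> I" for u
  proof -
    have q: "s * graph_slope x y u \<noteq> 0"
      by (rule less_imp_neq[OF s(2)[OF u], THEN not_sym])
    have "((\<lambda>u. travel_pos c (y u)) has_real_derivative
        inverse (slope_pos c (y u)) * (graph_slope x y u * d1 x u)) (at u)"
      by (rule DERIV_chain2[where f = "travel_pos c", OF travel_pos_has_derivative[OF c] y_derivative[OF u]])
    from DERIV_diff[OF has_derivative_d1[OF graph_facts(5) u] DERIV_cmult[OF this, of s]]
    have "((\<lambda>u. x u - s * travel_pos c (y u)) has_real_derivative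
        d1 x u - s * (inverse (slope_pos c (y u)) * (graph_slope x y u * d1 x u))) (at u)" .
    moreover have "s * (inverse (slope_pos c (y u)) * (graph_slope x y u * d1 x u)) = d1 x u"
    proof -
      have "s * (inverse (slope_pos c (y u)) * (graph_slope x y u * d1 x u))
          = (inverse (s * graph_slope x y u) * (s * graph_slope x y u)) * d1 x u"
        unfolding slope[OF u] by (simp only: mult_ac)
      also have "\<dots> = d1 x u" using left_inverse[OF q] by simp
      finally show ?thesis .
    qed
    ultimately show ?thesis by simp
  qed
  from constant_on_interval[OF graph_facts(2) this] obtain K
    where K: "\<And>u. u \<in> I \<Longrightarrow> x u - s * travel_pos c (y u) = K" by blast
  have "x u = s * travel_pos c (y u) + K" if "u \<in> I" for u
    using K[OF that] by linarith
  then have "\<forall>u\<in>I. vector [x u, y u] \<in> monotone_curve c K s"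
    unfolding monotone_curve_def by (simp add: vector_2)
  with monotone_curve_classified[OF c s(1)] show ?thesis by blast
qed

text \<open>The energy is the product of \<open>q - y\<^sup>2/\<surd>2\<close> and \<open>q + y\<^sup>2/\<surd>2\<close>. Each factor satisfies a
  homogeneous linear differential equation, so one of them vanishes identically and not
  merely at single points. The resulting equation \<open>y' = r (y\<^sup>2/\<surd>2) x'\<close> is again homogeneous
  linear in \<open>y\<close> (with a coefficient that depends on \<open>y\<close>): either \<open>y = 0\<close> throughout, or
  \<open>1/y\<close> is an affine function of \<open>x\<close>.\<close>

  

lemma zero_energy:
  assumes E: "\<And>u. u \<in> I \<Longrightarrow> graph_slope x y u ^ 2 = 1/2 * y u ^ 4"
  shows "\<exists>S\<in>classified_curves. \<forall>u\<in>I. vector [x u, y u] \<in> S"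
proof -
  define w where "w = (\<lambda>r u. graph_slope x y u - r * (y u ^ 2 / sqrt 2))"
  have sq: "sqrt 2 * sqrt 2 = (2::real)" by simp
  have w_ode: "(w r has_real_derivative (- (r * sqrt 2 * y u * d1 x u)) * w r u) (at u)"
    if r: "r = 1 \<or> r = - 1" and u: "u \<in> I" for r u
  proof -
    have rr: "r * r = 1" using r by auto
    have "((\<lambda>u. y u ^ 2) has_real_derivative 2 * y u * (graph_slope x y u * d1 x u)) (at u)"
      by (rule derivative_eq_intros refl y_derivative[OF u])+ simp
    from DERIV_diff[OF slope_derivative[OF u] DERIV_cmult[OF DERIV_cdivide[OF this, of "sqrt 2"], of r]]
    have "(w r has_real_derivative y u ^ 3 * d1 x u
        - r * (2 * y u * (graph_slope x y u * d1 x u) / sqrt 2)) (at u)"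
      unfolding w_def .
    moreover have "y u ^ 3 * d1 x u - r * (2 * y u * (graph_slope x y u * d1 x u) / sqrt 2)
      = (- (r * sqrt 2 * y u * d1 x u)) * w r u"
    proof -
      define i where "i = 1 / sqrt (2::real)"
      have i: "i * sqrt 2 = 1" "2 * i = sqrt 2" unfolding i_def using sq by (simp_all add: field_simps)
      have "y u ^ 3 * d1 x u - r * (2 * y u * (graph_slope x y u * d1 x u) * i)
        = (- (r * sqrt 2 * y u * d1 x u)) * (graph_slope x y u - r * (y u ^ 2 * i))"
        using i rr by algebra
      then show ?thesis unfolding w_def i_def by simp
    qed
    ultimately show ?thesis by simp
  qed
  have cont: "continuous_on I (\<lambda>u. c * y u * d1 x u)" for c
    by (intro continuous_intros continuous_y smooth_continuous[OF smooth_d1[OF graph_facts(5)]])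
  obtain u0 where u0: "u0 \<in> I" using graph_facts(4) by blast
  have "w 1 u0 * w (- 1) u0 = graph_slope x y u0 ^ 2 - (y u0 ^ 2 / sqrt 2) ^ 2"
    unfolding w_def by (simp add: algebra_simps power2_eq_square)
  also have "\<dots> = 0"
    using E[OF u0] by (simp add: power_divide flip: power_mult)
  finally obtain r where r: "r = 1 \<or> r = - 1" "w r u0 = 0" by auto
  have "w r u = 0" if "u \<in> I" for u
  proof (rule linear_ode_zero[OF graph_facts(2) w_ode[OF r(1)] _ u0 r(2) that])
    show "continuous_on I (\<lambda>u. - (r * sqrt 2 * y u * d1 x u))"
      using cont[of "- (r * sqrt 2)"] by simp
  qed
  then have q: "graph_slope x y u = r * (y u ^ 2 / sqrt 2)" if "u \<in> I" for u
    using that by (simp add: w_def)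
  have y_ode: "(y has_real_derivative (r / sqrt 2 * y u * d1 x u) * y u) (at u)" if u: "u \<in> I" for u
    using y_derivative[OF u] unfolding q[OF u] by (simp add: power2_eq_square mult_ac)
  show ?thesis
  proof (cases "\<exists>u\<in>I. y u = 0")
    case True
    then obtain v where v: "v \<in> I" "y v = 0" by blast
    have "y u = 0" if "u \<in> I" for u
      by (rule linear_ode_zero[OF graph_facts(2) y_ode cont v that])
    then have "\<forall>u\<in>I. vector [x u, y u] \<in> x_axis"
      by (simp add: x_axis_def vector_2)
    with x_axis_classified show ?thesis by blast
  next
    case False
    then have nz: "y u \<noteq> 0" if "u \<in> I" for u using that by blast
    have rr: "r * r = 1" using r(1) by auto
    have "((\<lambda>u. inverse (y u) + r / sqrt 2 * x u) has_real_derivative 0) (at u)" if u: "u \<in> I" for u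
      by (rule derivative_eq_intros refl y_ode[OF u] has_derivative_d1[OF graph_facts(5) u] nz[OF u])+
        (use nz[OF u] in \<open>simp add: field_simps\<close>)
    from constant_on_interval[OF graph_facts(2) this] obtain K
      where K: "\<And>u. u \<in> I \<Longrightarrow> inverse (y u) + r / sqrt 2 * x u = K" by blast
    \<comment> \<open>The abscissa at which \<open>1 / y\<close> would vanish.\<close>
    define C where "C = K * r * sqrt 2"
    have eq: "(x u - C) * y u = - r * sqrt 2" if u: "u \<in> I" for u
    proof -
      define i j where "i = 1 / sqrt (2::real)" and "j = inverse (y u)"
      have ij: "i * sqrt 2 = 1" "j * y u = 1" unfolding i_def j_def using nz[OF u] by simp_all
      have "j + r * i * x u = K" using K[OF u] by (simp add: i_def j_def)
      with ij rr show ?thesis unfolding C_def by algebra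
    qed
    have "x u - C \<noteq> 0" if "u \<in> I" for u
      using eq[OF that] r(1) by auto
    moreover have "continuous_on I (\<lambda>u. x u - C)"
      by (intro continuous_intros smooth_continuous[OF graph_facts(5)])
    ultimately obtain s where s: "s = 1 \<or> s = - 1" "\<And>u. u \<in> I \<Longrightarrow> s * (x u - C) > 0"
      using constant_sign[OF graph_facts(2), of "\<lambda>u. x u - C"] by blast
    have "\<forall>u\<in>I. vector [x u, y u] \<in> hyperbola_branch C (- r) s"
      unfolding hyperbola_branch_def using eq s(2) by (simp add: vector_2 less_imp_le)
    moreover have "- r = 1 \<or> - r = - 1" using r(1) by auto
    ultimately show ?thesis using hyperbola_branch_classified[OF _ s(1)] by blast
  qed
qed

text \<open>The height satisfies \<open>a \<le> s y\<close> for a sign \<open>s\<close>. The variables cannot be separated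
  directly, because the slope vanishes at the vertex, and \<open>\<surd>(s y - a)\<close> is not differentiable
  there. Dividing the slope by its positive factor gives the smooth choice of sign for that
  root: \<open>t = s q / R\<close> has the square \<open>s y - a\<close> and satisfies \<open>t' = R x' / 2\<close>, so that \<open>x -
  travel_neg a t\<close> is constant.\<close>

  

lemma negative_energy:
  assumes a: "a > 0" and E: "\<And>u. u \<in> I \<Longrightarrow> graph_slope x y u ^ 2 = 1/2 * y u ^ 4 - a ^ 4 / 2"
  shows "\<exists>S\<in>classified_curves. \<forall>u\<in>I. vector [x u, y u] \<in> S"
proof -
  have ge: "a \<le> \<bar>y u\<bar>" if "u \<in> I" for u
  proof -
    have "0 \<le> 1/2 * y u ^ 4 - a ^ 4 / 2" using E[OF that] zero_le_power2[of "graph_slope x y u"] by simp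
    then have "a ^ 4 \<le> \<bar>y u\<bar> ^ 4" by simp
    then show ?thesis using power_le_imp_le_base[of a 3 "\<bar>y u\<bar>"] by simp
  qed
  have "y u \<noteq> 0" if "u \<in> I" for u using ge[OF that] a by auto
  then obtain s where s: "s = 1 \<or> s = - 1" "\<And>u. u \<in> I \<Longrightarrow> s * y u > 0"
    using constant_sign[OF graph_facts(2) continuous_y] by blast
  have ss: "s * s = 1" using s(1) by auto
  define h where "h = (\<lambda>u. s * y u - a)"
  have h: "h u \<ge> 0" if "u \<in> I" for u
    using ge[OF that] s(1) s(2)[OF that] unfolding h_def by auto
  have sy: "y u = s * (a + h u)" for u
    using ss unfolding h_def by algebra
  define R where "R = (\<lambda>u. sqrt (quotient_poly a (h u) / 2))"
  have R: "R u > 0" "R u ^ 2 = quotient_poly a (h u) / 2" if "u \<in> I" for u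
    using quotient_poly_pos[OF a h[OF that]] by (simp_all add: R_def)
  define t where "t = (\<lambda>u. s * graph_slope x y u / R u)"
  have tR: "t u * R u = s * graph_slope x y u" if "u \<in> I" for u
    using R(1)[OF that] by (simp add: t_def)
  have t2: "t u ^ 2 = h u" if u: "u \<in> I" for u
  proof -
    have "graph_slope x y u ^ 2 = h u * (quotient_poly a (h u) / 2)"
      using E[OF u] ss unfolding sy[of u] quotient_poly_def by algebra
    then have "(t u * R u) ^ 2 = h u * R u ^ 2"
      unfolding tR[OF u] R(2)[OF u] using ss by algebra
    then show ?thesis using R(1)[OF u] by (simp add: power_mult_distrib)
  qed
  have slope: "slope_neg a (t u) = R u" if "u \<in> I" for u
    unfolding slope_neg_def t2[OF that] R_def ..
  have dt: "(t has_real_derivative R u * d1 x u / 2) (at u)" if u: "u \<in> I" for u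
  proof -
    define Q' where "Q' = 6 * a ^ 2 + 8 * a * h u + 3 * h u ^ 2"
    have dh: "(h has_real_derivative s * (graph_slope x y u * d1 x u)) (at u)"
      unfolding h_def by (rule derivative_eq_intros refl y_derivative[OF u])+ simp
    have "((\<lambda>u. quotient_poly a (h u) / 2) has_real_derivative
        Q' * (s * (graph_slope x y u * d1 x u)) / 2) (at u)"
      unfolding quotient_poly_def Q'_def
      by (rule derivative_eq_intros refl dh)+ (simp_all add: field_simps)
    from DERIV_chain2[where f = sqrt, OF DERIV_real_sqrt this] quotient_poly_pos[OF a h[OF u]]
    have dR: "(R has_real_derivative inverse (R u) / 2 * (Q' * (s * (graph_slope x y u * d1 x u)) / 2)) (at u)"
      unfolding R_def by simp
    have Rnz: "R u \<noteq> 0" using R(1)[OF u] by simp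
    define i where "i = inverse (R u)"
    have i: "i * R u = 1" using Rnz by (simp add: i_def)
    have "(t has_real_derivative (s * (y u ^ 3 * d1 x u) * R u - s * graph_slope x y u *
        (inverse (R u) / 2 * (Q' * (s * (graph_slope x y u * d1 x u)) / 2))) / (R u * R u)) (at u)"
      unfolding t_def by (rule DERIV_divide[OF DERIV_cmult[OF slope_derivative[OF u]] dR Rnz])
    moreover have "(s * (y u ^ 3 * d1 x u) * R u - s * graph_slope x y u *
        (inverse (R u) / 2 * (Q' * (s * (graph_slope x y u * d1 x u)) / 2))) / (R u * R u)
      = R u * d1 x u / 2"
    proof -
      have y3: "s * y u ^ 3 = (a + h u) ^ 3" using ss unfolding sy[of u] by algebra
      have poly: "quotient_poly a (h u) + h u * Q' = 4 * (a + h u) ^ 3"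
        unfolding quotient_poly_def Q'_def by algebra
      have "s * (y u ^ 3 * d1 x u) * R u - (t u * R u) * (i / 2 * (Q' * ((t u * R u) * d1 x u) / 2))
          = R u * d1 x u * (4 * (a + h u) ^ 3 - t u ^ 2 * Q') / 4"
        unfolding y3[symmetric] using i by (simp add: field_simps power2_eq_square)
      also have "\<dots> = R u * d1 x u / 2 * (R u * R u)"
        unfolding t2[OF u] poly[symmetric] using R(2)[OF u] by (simp add: power2_eq_square)
      finally have "s * (y u ^ 3 * d1 x u) * R u - s * graph_slope x y u *
        (i / 2 * (Q' * (s * (graph_slope x y u * d1 x u)) / 2)) = R u * d1 x u / 2 * (R u * R u)"
        unfolding tR[OF u] by (simp only: mult.assoc)
      then show ?thesis unfolding i_def using Rnz by simp
    qed
    ultimately show ?thesis by (simp only:)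
  qed
  have "((\<lambda>u. x u - travel_neg a (t u)) has_real_derivative 0) (at u)" if u: "u \<in> I" for u
  proof -
    have "((\<lambda>u. travel_neg a (t u)) has_real_derivative
        2 * inverse (slope_neg a (t u)) * (R u * d1 x u / 2)) (at u)"
      by (rule DERIV_chain2[where f = "travel_neg a", OF travel_neg_has_derivative[OF a] dt[OF u]])
    moreover have "2 * inverse (slope_neg a (t u)) * (R u * d1 x u / 2) = d1 x u"
      unfolding slope[OF u] using R(1)[OF u] by (simp add: field_simps)
    ultimately have "((\<lambda>u. travel_neg a (t u)) has_real_derivative d1 x u) (at u)"
      by (simp only:)
    from DERIV_diff[OF has_derivative_d1[OF graph_facts(5) u] this] show ?thesis by simp
  qed
  from constant_on_interval[OF graph_facts(2) this] obtain K
    where K: "\<And>u. u \<in> I \<Longrightarrow> x u - travel_neg a (t u) = K" by blast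
  have "vector [x u, y u] \<in> vertex_curve a K s" if u: "u \<in> I" for u
  proof -
    have "x u = K + travel_neg a (t u)" "y u = s * (a + t u ^ 2)"
      using K[OF u] sy[of u] t2[OF u] by simp_all
    with complete_vertex_curve[OF a s(1), of K] show ?thesis
      unfolding complete_solution_def by auto
  qed
  with vertex_curve_classified[OF a s(1)] show ?thesis by blast
qed

end

lemma solution_in_classified_curve:
  assumes Y: "solution I Y"
  shows "\<exists>S\<in>classified_curves. Y ` I \<subseteq> S"
proof -
  define x y where "x = (\<lambda>u. Y u $ 1)" and "y = (\<lambda>u. Y u $ 2)"
  have sol: "plane_solution I x y" using Y by (simp add: solution_iff x_def y_def)
  note D = plane_solutionD[OF sol]
  have Yxy: "Y u = vector [x u, y u]" for u by (simp add: vec2_eq_iff x_def y_def)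
  have "\<exists>S\<in>classified_curves. \<forall>u\<in>I. vector [x u, y u] \<in> S"
    using vertical_or_graph[OF sol]
  proof
    assume "\<forall>u\<in>I. d1 x u = 0"
    then have "(x has_real_derivative 0) (at u)" if "u \<in> I" for u
      using has_derivative_d1[OF D(5) that] that by simp
    from constant_on_interval[OF D(2) this] obtain K where "\<And>u. u \<in> I \<Longrightarrow> x u = K" by blast
    then have "\<forall>u\<in>I. vector [x u, y u] \<in> vertical_line K"
      by (simp add: vertical_line_def vector_2)
    with vertical_line_classified show ?thesis by blast
  next
    assume "\<forall>u\<in>I. d1 x u \<noteq> 0"
    then have g: "\<And>u. u \<in> I \<Longrightarrow> d1 x u \<noteq> 0" by blast
    obtain c where c: "\<And>u. u \<in> I \<Longrightarrow> graph_slope x y u ^ 2 = 1/2 * y u ^ 4 + c"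
      using energy_constant[OF sol g] by blast
    consider "c > 0" | "c = 0" | "c < 0" by linarith
    then show ?thesis
    proof cases
      case 1
      from positive_energy[OF sol g this c] show ?thesis .
    next
      case 2
      with zero_energy[OF sol g] c show ?thesis by simp
    next
      case 3
      define a where "a = root 4 (- 2 * c)"
      have a: "a > 0" "c = - (a ^ 4 / 2)" using 3 by (simp_all add: a_def)
      with negative_energy[OF sol g a(1)] c show ?thesis by simp
    qed
  qed
  then show ?thesis unfolding Yxy[abs_def] image_subset_iff by (simp add: image_subset_iff)
qed

section \<open>The curves as graphs\<close>

text \<open>On the graph the equation is \<open>f'' = f\<^sup>3\<close>; convexity and inflection points can be read
  off from the sign of \<open>f\<close>.\<close>

  

lemma graph_of_complete_solution:
  assumes S: "complete_solution X Z S" and nz: "\<And>t. d1 X t \<noteq> 0"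
  defines "f \<equiv> \<lambda>x. Z (inv X x)" and "g \<equiv> \<lambda>x. d1 Z (inv X x) / d1 X (inv X x)"
  shows "open_interval (range X)" "inj X" "S = graph_on (range X) f"
    "\<And>x. x \<in> range X \<Longrightarrow> (f has_real_derivative g x) (at x)"
    "\<And>x. x \<in> range X \<Longrightarrow> (g has_real_derivative f x ^ 3) (at x)"
proof -
  have sol: "plane_solution UNIV X Z" and rng: "range (\<lambda>t. vector [X t, Z t]) = S"
    using S by (auto simp: complete_solution_def)
  note D = plane_solutionD[OF sol]
  have dX: "(X has_real_derivative d1 X t) (at t)" and dX': "(d1 X has_real_derivative d2 X t) (at t)"
    and dZ: "(Z has_real_derivative d1 Z t) (at t)" and dZ': "(d1 Z has_real_derivative d2 Z t) (at t)" for t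
    by (rule has_derivative_d1[OF D(5) UNIV_I] has_derivative_d2[OF D(5) UNIV_I] has_derivative_d1[OF D(6) UNIV_I] has_derivative_d2[OF D(6) UNIV_I])+
  note inv = inv_has_derivative[of X "d1 X", OF dX nz]
  show "inj X" by (rule inv(1))
  have "connected (range X)"
    by (rule connected_continuous_image[OF smooth_continuous[OF D(5)] connected_UNIV])
  then show "open_interval (range X)"
    using inv(2) by (simp add: open_interval_def is_interval_connected_1)
  have inv_X: "inv X (X t) = t" for t by (rule inv_f_f[OF inv(1)])
  show "S = graph_on (range X) f"
  proof -
    have "graph_on (range X) f = (\<lambda>x. vector [x, f x]) ` range X"
      by (auto simp: graph_on_def)
    also have "\<dots> = S"
      unfolding rng[symmetric] image_image f_def inv_X ..
    finally show ?thesis ..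
  qed
  show "(f has_real_derivative g x) (at x)" if x: "x \<in> range X" for x
  proof -
    obtain t where t: "x = X t" using x by blast
    have "(Z has_real_derivative d1 Z t) (at (inv X (X t)))" unfolding inv_X by (rule dZ)
    from DERIV_chain2[where f = Z and g = "inv X", OF this inv(3)] show ?thesis
      unfolding f_def g_def t inv_X by (simp add: divide_inverse)
  qed
  show "(g has_real_derivative f x ^ 3) (at x)" if x: "x \<in> range X" for x
  proof -
    obtain t where t: "x = X t" using x by blast
    define m where "m = (\<lambda>t. d1 Z t / d1 X t)"
    have "(m has_real_derivative (d2 Z t * d1 X t - d1 Z t * d2 X t) / (d1 X t * d1 X t)) (at (inv X (X t)))"
      unfolding m_def inv_X by (rule DERIV_divide[OF dZ' dX' nz])
    from DERIV_chain2[where f = m and g = "inv X", OF this inv(3)]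
    have "((\<lambda>x. m (inv X x)) has_real_derivative
      (d2 Z t * d1 X t - d1 Z t * d2 X t) / (d1 X t * d1 X t) * inverse (d1 X t)) (at x)"
      unfolding t .
    moreover have "d2 Z t * d1 X t - d1 Z t * d2 X t = Z t ^ 3 * d1 X t ^ 3"
      using D(8)[of t] by (simp add: mult.commute)
    moreover have "Z t ^ 3 * d1 X t ^ 3 / (d1 X t * d1 X t) * inverse (d1 X t) = Z t ^ 3"
      using nz[of t] by (simp add: power3_eq_cube)
    ultimately show ?thesis
      unfolding g_def f_def m_def t inv_X by simp
  qed
qed

lemma vertex_curve_graph:
  assumes a: "a > 0" and s: "s = 1 \<or> s = - 1"
  obtains I f g where "open_interval I" "vertex_curve a C2 s = graph_on I f"
    "\<And>x. x \<in> I \<Longrightarrow> (f has_real_derivative g x) (at x)"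
    "\<And>x. x \<in> I \<Longrightarrow> (g has_real_derivative f x ^ 3) (at x)"
    "\<And>x. x \<in> I \<Longrightarrow> s * f x \<ge> a" "C2 \<in> I" "\<And>x. x \<in> I \<Longrightarrow> s * f x = a \<longleftrightarrow> x = C2"
proof -
  define X Z where "X = (\<lambda>t. C2 + travel_neg a t)" and "Z = (\<lambda>t. s * (a + t ^ 2))"
  have S: "complete_solution X Z (vertex_curve a C2 s)"
    unfolding X_def Z_def by (rule complete_vertex_curve[OF a s])
  have nz: "d1 X t \<noteq> 0" for t
  proof -
    have "(X has_real_derivative 2 * inverse (slope_neg a t)) (at t)"
      unfolding X_def by (rule derivative_eq_intros refl travel_neg_has_derivative[OF a])+ simp
    from d1_unique[OF this] show ?thesis using slope_neg_pos[OF a, of t] by simp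
  qed
  note G = graph_of_complete_solution[OF S nz]
  have inv_X: "inv X (X t) = t" for t by (rule inv_f_f[OF G(2)])
  have X0: "X 0 = C2" by (simp add: X_def)
  have sZ: "s * Z t = a + t ^ 2" for t using s by (auto simp: Z_def)
  show thesis
  proof (rule that[OF G(1) G(3) G(4) G(5)])
    show "a \<le> s * Z (inv X x)" for x unfolding sZ by simp
    show "C2 \<in> range X" using X0 by (metis rangeI)
    show "s * Z (inv X x) = a \<longleftrightarrow> x = C2" if x: "x \<in> range X" for x
    proof -
      obtain t where t: "x = X t" using x by blast
      have "X t = X 0 \<longleftrightarrow> t = 0" using G(2) by (rule inj_eq)
      then show ?thesis unfolding t inv_X sZ X0[symmetric] by simp
    qed
  qed
qed

lemma convex_curve_graph:
  assumes C: "C1 > 0"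
  shows "\<exists>I f. open_interval I \<and> convex_curve C1 C2 = graph_on I f \<and> convex_on I f
    \<and> (\<forall>x. is_arg_min f (\<lambda>t. t \<in> I) x \<longleftrightarrow> x = C2)"
proof -
  define a where "a = root 4 (2 * C1)"
  have a: "a > 0" using root4(1)[OF C] by (simp add: a_def)
  obtain I f g where G: "open_interval I" "vertex_curve a C2 1 = graph_on I f"
    "\<And>x. x \<in> I \<Longrightarrow> (f has_real_derivative g x) (at x)"
    "\<And>x. x \<in> I \<Longrightarrow> (g has_real_derivative f x ^ 3) (at x)"
    "\<And>x. x \<in> I \<Longrightarrow> 1 * f x \<ge> a" "C2 \<in> I" "\<And>x. x \<in> I \<Longrightarrow> 1 * f x = a \<longleftrightarrow> x = C2"
    by (rule vertex_curve_graph[OF a, of 1 C2]) (simp, rule that)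
  have "convex I" using G(1) by (simp add: open_interval_def is_interval_convex)
  then have "convex_on I f"
  proof (rule f''_ge0_imp_convex[OF _ G(3) G(4)])
    show "0 \<le> f x ^ 3" if "x \<in> I" for x using G(5)[OF that] a by simp
  qed
  moreover have "is_arg_min f (\<lambda>t. t \<in> I) x \<longleftrightarrow> x = C2" for x
  proof
    assume "is_arg_min f (\<lambda>t. t \<in> I) x"
    then have x: "x \<in> I" "f x \<le> f C2" using G(6) by (auto simp: is_arg_min_def not_less)
    then show "x = C2" using G(5)[OF x(1)] G(7)[OF x(1)] G(7)[OF G(6)] by linarith
  next
    assume x: "x = C2"
    have "f C2 = a" using G(7)[OF G(6)] by simp
    then have "f C2 \<le> f y" if "y \<in> I" for y using G(5)[OF that] by simp
    with G(6) show "is_arg_min f (\<lambda>t. t \<in> I) x"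
      unfolding x by (auto simp: is_arg_min_def not_less)
  qed
  ultimately show ?thesis
    using G(1,2) unfolding convex_curve_eq[OF C] a_def[symmetric]
    by (intro exI[of _ I] exI[of _ f] conjI allI)
qed

lemma concave_curve_graph:
  assumes C: "C1 > 0"
  shows "\<exists>I f. open_interval I \<and> concave_curve C1 C2 = graph_on I f \<and> concave_on I f
    \<and> (\<forall>x. is_arg_max f (\<lambda>t. t \<in> I) x \<longleftrightarrow> x = C2)"
proof -
  define a where "a = root 4 (2 * C1)"
  have a: "a > 0" using root4(1)[OF C] by (simp add: a_def)
  obtain I f g where G: "open_interval I" "vertex_curve a C2 (- 1) = graph_on I f"
    "\<And>x. x \<in> I \<Longrightarrow> (f has_real_derivative g x) (at x)"
    "\<And>x. x \<in> I \<Longrightarrow> (g has_real_derivative f x ^ 3) (at x)"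
    "\<And>x. x \<in> I \<Longrightarrow> - 1 * f x \<ge> a" "C2 \<in> I" "\<And>x. x \<in> I \<Longrightarrow> - 1 * f x = a \<longleftrightarrow> x = C2"
    by (rule vertex_curve_graph[OF a, of "- 1" C2]) (simp, rule that)
  have "convex I" using G(1) by (simp add: open_interval_def is_interval_convex)
  then have "convex_on I (\<lambda>x. - f x)"
  proof (rule f''_ge0_imp_convex)
    show "((\<lambda>x. - f x) has_real_derivative - g x) (at x)" if "x \<in> I" for x
      by (rule DERIV_minus[OF G(3)[OF that]])
    show "((\<lambda>x. - g x) has_real_derivative - (f x ^ 3)) (at x)" if "x \<in> I" for x
      by (rule DERIV_minus[OF G(4)[OF that]])
    show "0 \<le> - (f x ^ 3)" if "x \<in> I" for x
      using G(5)[OF that] a zero_le_power[of "- f x" 3] by simp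
  qed
  then have "concave_on I f" by (simp add: concave_on_def)
  moreover have "is_arg_max f (\<lambda>t. t \<in> I) x \<longleftrightarrow> x = C2" for x
  proof
    assume "is_arg_max f (\<lambda>t. t \<in> I) x"
    then have x: "x \<in> I" "f C2 \<le> f x" using G(6) by (auto simp: is_arg_max_def not_less)
    then show "x = C2" using G(5)[OF x(1)] G(7)[OF x(1)] G(7)[OF G(6)] by linarith
  next
    assume x: "x = C2"
    have "- f C2 = a" using G(7)[OF G(6)] by simp
    then have "f y \<le> f C2" if "y \<in> I" for y using G(5)[OF that] by simp
    with G(6) show "is_arg_max f (\<lambda>t. t \<in> I) x"
      unfolding x by (auto simp: is_arg_max_def not_less)
  qed
  ultimately show ?thesis
    using G(1,2) unfolding concave_curve_eq[OF C] a_def[symmetric]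
    by (intro exI[of _ I] exI[of _ f] conjI allI)
qed

text \<open>Since \<open>f'' = f\<^sup>3\<close> has the sign of \<open>f\<close>, it changes sign at \<open>c0\<close>. Any other candidate
  has points on both of its sides that lie on the same side of \<open>c0\<close>.\<close>

  

lemma inflection_point_iff:
  fixes f g :: "real \<Rightarrow> real"
  assumes I: "open I"
    and f: "\<And>x. x \<in> I \<Longrightarrow> (f has_real_derivative g x) (at x)"
    and g: "\<And>x. x \<in> I \<Longrightarrow> (g has_real_derivative f x ^ 3) (at x)"
    and c0: "c0 \<in> I" and s: "s = 1 \<or> s = - 1"
    and pos: "\<And>x. x \<in> I \<Longrightarrow> s * (x - c0) > 0 \<Longrightarrow> f x > 0"
    and neg: "\<And>x. x \<in> I \<Longrightarrow> s * (x - c0) < 0 \<Longrightarrow> f x < 0"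
  shows "inflection_point I f c \<longleftrightarrow> c = c0"
proof -
  have df: "deriv f x = g x" if "x \<in> I" for x
    by (rule DERIV_imp_deriv[OF f[OF that]])
  have ddf: "(deriv f has_real_derivative f x ^ 3) (at x)" if "x \<in> I" for x
    by (rule has_field_derivative_transform_within_open[OF g[OF that] I that]) (rule df[symmetric])
  have dd: "deriv (deriv f) x = f x ^ 3" if "x \<in> I" for x
    by (rule DERIV_imp_deriv[OF ddf[OF that]])
  have spos: "deriv (deriv f) x > 0" if "x \<in> I" "s * (x - c0) > 0" for x
    unfolding dd[OF that(1)] using pos[OF that] by simp
  have sneg: "deriv (deriv f) x < 0" if "x \<in> I" "s * (x - c0) < 0" for x
    unfolding dd[OF that(1)] using neg[OF that] by simp
  show ?thesis
  proof
    assume c: "c = c0"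
    obtain e where e: "e > 0" "ball c0 e \<subseteq> I" using I c0 by (rule openE)
    then have sub: "{c - e<..<c + e} \<subseteq> I" unfolding c by (simp add: ball_eq_greaterThanLessThan)
    have diff: "f differentiable (at x) \<and> deriv f differentiable (at x)" if "x \<in> {c - e<..<c + e}" for x
      using f ddf sub that unfolding real_differentiable_def by blast
    have "(\<forall>x\<in>{c - e<..<c}. deriv (deriv f) x < 0) \<and> (\<forall>x\<in>{c<..<c + e}. deriv (deriv f) x > 0) \<or>
      (\<forall>x\<in>{c - e<..<c}. deriv (deriv f) x > 0) \<and> (\<forall>x\<in>{c<..<c + e}. deriv (deriv f) x < 0)"
      using s
    proof
      assume s1: "s = 1"
      have "deriv (deriv f) x < 0" if "x \<in> {c - e<..<c}" for x
        by (rule sneg) (use that sub s1 c e(1) in auto)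
      moreover have "deriv (deriv f) x > 0" if "x \<in> {c<..<c + e}" for x
        by (rule spos) (use that sub s1 c e(1) in auto)
      ultimately show ?thesis by blast
    next
      assume s1: "s = - 1"
      have "deriv (deriv f) x > 0" if "x \<in> {c - e<..<c}" for x
        by (rule spos) (use that sub s1 c e(1) in auto)
      moreover have "deriv (deriv f) x < 0" if "x \<in> {c<..<c + e}" for x
        by (rule sneg) (use that sub s1 c e(1) in auto)
      ultimately show ?thesis by blast
    qed
    with e(1) sub diff show "inflection_point I f c"
      unfolding inflection_point_def by blast
  next
    assume "inflection_point I f c"
    then obtain e where e: "e > 0" "{c - e<..<c + e} \<subseteq> I"
      and change: "(\<forall>x\<in>{c - e<..<c}. deriv (deriv f) x < 0) \<and> (\<forall>x\<in>{c<..<c + e}. deriv (deriv f) x > 0) \<or>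
      (\<forall>x\<in>{c - e<..<c}. deriv (deriv f) x > 0) \<and> (\<forall>x\<in>{c<..<c + e}. deriv (deriv f) x < 0)"
      unfolding inflection_point_def by blast
    have differ: False if p: "p \<in> {c - e<..<c}" and q: "q \<in> {c<..<c + e}"
      and side: "c0 < p \<and> c0 < q \<or> p < c0 \<and> q < c0" for p q
    proof -
      have I: "p \<in> I" "q \<in> I" using p q e by auto
      have "s * (p - c0) > 0 \<and> s * (q - c0) > 0 \<or> s * (p - c0) < 0 \<and> s * (q - c0) < 0"
        using side s by auto
      then have "deriv (deriv f) p > 0 \<and> deriv (deriv f) q > 0 \<or> deriv (deriv f) p < 0 \<and> deriv (deriv f) q < 0"
        using spos[OF I(1)] spos[OF I(2)] sneg[OF I(1)] sneg[OF I(2)] by blast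
      with change p q show False by force
    qed
    show "c = c0"
    proof (cases c c0 rule: linorder_cases)
      case less
      obtain q where "c < q" "q < min (c + e) c0"
        using dense[of c "min (c + e) c0"] less e(1) by auto
      with less differ[of "c - e / 2" q] e(1) show ?thesis by auto
    next
      case greater
      obtain p where "max (c - e) c0 < p" "p < c"
        using dense[of "max (c - e) c0" c] greater e(1) by auto
      with greater differ[of p "c + e / 2"] e(1) show ?thesis by auto
    qed
  qed
qed

lemma monotone_curve_graph:
  assumes C: "C1 > 0" and s: "s = 1 \<or> s = - 1"
  obtains I f where "open_interval I" "monotone_curve C1 C2 s = graph_on I f"
    "\<And>x y. x \<in> I \<Longrightarrow> y \<in> I \<Longrightarrow> s * x < s * y \<Longrightarrow> f x < f y"
    "\<And>x. inflection_point I f x \<longleftrightarrow> x = C2"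
proof -
  define X where "X = (\<lambda>t. s * travel_pos C1 t + C2)"
  have S: "complete_solution X (\<lambda>t. t) (monotone_curve C1 C2 s)"
    unfolding X_def by (rule complete_monotone_curve[OF C s])
  have nz: "d1 X t \<noteq> 0" for t
  proof -
    have "(X has_real_derivative s * inverse (slope_pos C1 t)) (at t)"
      unfolding X_def by (rule derivative_eq_intros refl travel_pos_has_derivative[OF C])+ simp
    from d1_unique[OF this] show ?thesis using slope_pos_pos[OF C, of t] s by auto
  qed
  note G = graph_of_complete_solution[OF S nz]
  have inv_X: "inv X (X t) = t" for t by (rule inv_f_f[OF G(2)])
  have X0: "X 0 = C2" by (simp add: X_def)
  have mono: "travel_pos C1 t < travel_pos C1 t'" if "t < t'" for t t'
  proof (rule DERIV_pos_imp_increasing[OF that])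
    show "\<exists>y. (travel_pos C1 has_real_derivative y) (at x) \<and> y > 0" for x
      using travel_pos_has_derivative[OF C, of x]
        positive_imp_inverse_positive[OF slope_pos_pos[OF C, of x]] by blast
  qed
  have ss: "s * (s * r) = r" for r using s by auto
  have X_mono: "s * X t < s * X t'" if "t < t'" for t t'
    using mono[OF that] unfolding X_def by (simp add: distrib_left ss)
  have order: "t < t'" if lt: "s * X t < s * X t'" for t t'
  proof (cases t t' rule: linorder_cases)
    case equal
    with lt show ?thesis by simp
  next
    case greater
    from less_asym[OF lt X_mono[OF greater]] show ?thesis ..
  qed
  have inc: "inv X x < inv X y" if x: "x \<in> range X" and y: "y \<in> range X" and lt: "s * x < s * y" for x y
  proof -
    obtain t t' where t: "x = X t" "y = X t'" using x y by blast
    show ?thesis using order lt unfolding t inv_X by blast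
  qed
  have C2: "C2 \<in> range X" "inv X C2 = 0"
    using rangeI[of X 0] inv_X[of 0] unfolding X0 .
  show thesis
  proof (rule that[OF G(1) G(3) inc])
    show "inflection_point (range X) (inv X) x \<longleftrightarrow> x = C2" for x
    proof (rule inflection_point_iff[OF _ G(4) G(5) C2(1) s])
      show "open (range X)" using G(1) by (simp add: open_interval_def)
      show "0 < inv X x" if "x \<in> range X" "0 < s * (x - C2)" for x
        using inc[OF C2(1) that(1)] that(2) unfolding C2(2) by (simp add: right_diff_distrib)
      show "inv X x < 0" if "x \<in> range X" "s * (x - C2) < 0" for x
        using inc[OF that(1) C2(1)] that(2) unfolding C2(2) by (simp add: right_diff_distrib)
    qed
  qed
qed

lemma increasing_curve_graph:
  assumes C: "C1 > 0"
  shows "\<exists>I f. open_interval I \<and> increasing_curve C1 C2 = graph_on I f \<and> strict_mono_on I f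
    \<and> (\<forall>x. inflection_point I f x \<longleftrightarrow> x = C2)"
proof -
  obtain I f where G: "open_interval I" "monotone_curve C1 C2 1 = graph_on I f"
    "\<And>x y. x \<in> I \<Longrightarrow> y \<in> I \<Longrightarrow> 1 * x < 1 * y \<Longrightarrow> f x < f y"
    "\<And>x. inflection_point I f x \<longleftrightarrow> x = C2"
    by (rule monotone_curve_graph[OF C, of 1 C2]) (simp, rule that)
  have "strict_mono_on I f" by (intro monotone_onI G(3)) simp_all
  with G(1,2,4) show ?thesis
    unfolding increasing_curve_eq by (intro exI[of _ I] exI[of _ f] conjI allI)
qed

lemma decreasing_curve_graph:
  assumes C: "C1 > 0"
  shows "\<exists>I f. open_interval I \<and> decreasing_curve C1 C2 = graph_on I f \<and> strict_antimono_on I f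
    \<and> (\<forall>x. inflection_point I f x \<longleftrightarrow> x = C2)"
proof -
  obtain I f where G: "open_interval I" "monotone_curve C1 C2 (- 1) = graph_on I f"
    "\<And>x y. x \<in> I \<Longrightarrow> y \<in> I \<Longrightarrow> - 1 * x < - 1 * y \<Longrightarrow> f x < f y"
    "\<And>x. inflection_point I f x \<longleftrightarrow> x = C2"
    by (rule monotone_curve_graph[OF C, of "- 1" C2]) (simp, rule that)
  have "strict_antimono_on I f" by (intro monotone_onI G(3)) simp_all
  with G(1,2,4) show ?thesis
    unfolding decreasing_curve_eq by (intro exI[of _ I] exI[of _ f] conjI allI)
qed

theorem theorem3p2:
  shows "(\<forall>I Y. maximal_solution I Y \<longleftrightarrow> (\<exists>S\<in>classified_curves. parametrizes I Y S))
    \<and> (\<forall>S\<in>classified_curves. \<exists>I Y. parametrizes I Y S)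
    \<and> (\<forall>C1>0. \<forall>C2.
        (\<exists>I f. open_interval I \<and> convex_curve C1 C2 = graph_on I f \<and> convex_on I f
              \<and> (\<forall>x. is_arg_min f (\<lambda>t. t \<in> I) x \<longleftrightarrow> x = C2))
      \<and> (\<exists>I f. open_interval I \<and> concave_curve C1 C2 = graph_on I f \<and> concave_on I f
              \<and> (\<forall>x. is_arg_max f (\<lambda>t. t \<in> I) x \<longleftrightarrow> x = C2))
      \<and> (\<exists>I f. open_interval I \<and> increasing_curve C1 C2 = graph_on I f \<and> strict_mono_on I f
              \<and> (\<forall>x. inflection_point I f x \<longleftrightarrow> x = C2))
      \<and> (\<exists>I f. open_interval I \<and> decreasing_curve C1 C2 = graph_on I f \<and> strict_antimono_on I f
              \<and> (\<forall>x. inflection_point I f x \<longleftrightarrow> x = C2)))"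
proof (intro conjI allI impI ballI)
  fix I Y
  show "maximal_solution I Y \<longleftrightarrow> (\<exists>S\<in>classified_curves. parametrizes I Y S)"
  proof
    assume Y: "maximal_solution I Y"
    then have "solution I Y" by (simp add: maximal_solution_def)
    then obtain S where S: "S \<in> classified_curves" "Y ` I \<subseteq> S"
      using solution_in_classified_curve by blast
    obtain X Z where "complete_solution X Z S" using classified_complete[OF S(1)] by blast
    from maximal_solution_onto[OF this Y S(2)] S(1)
    show "\<exists>S\<in>classified_curves. parametrizes I Y S" by blast
  next
    assume "\<exists>S\<in>classified_curves. parametrizes I Y S"
    then obtain S where S: "S \<in> classified_curves" "parametrizes I Y S" by blast
    obtain X Z where "complete_solution X Z S" using classified_complete[OF S(1)] by blast
    from parametrization_maximal[OF this S(2)] show "maximal_solution I Y" .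
  qed
next
  fix S assume "S \<in> classified_curves"
  then show "\<exists>I Y. parametrizes I Y S"
    using classified_complete complete_solution_parametrizes by blast
qed (rule convex_curve_graph concave_curve_graph increasing_curve_graph decreasing_curve_graph, assumption)+

end
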